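(* Let $n\ge 2$, $\lambda>1$, $\nu=\sqrt{\lambda^2-1}$ and $C(\lambda)=\lambda\nu^{n-1}$. Let $f\in C_c^\infty(\mathbb{R}^n)$ with $f(x',x_n)=f(x',-x_n)$ for $(x',x_n)\in\mathbb{R}^{n-1}\times\mathbb{R}$. Then for $x=(x_1,\tilde x,x_n)\in\mathbb{R}\times\mathbb{R}^{n-2}\times\mathbb{R}$ with $x_n>0$, $$ f(x)=\frac{x_n}{(2\pi)^n\,C(\lambda)^2}\int_{\mathbb{R}^n}e^{-i\frac{|\alpha|^2}{4\gamma}}\,e^{i\alpha\cdot\left(\frac{x_1}{\lambda},\frac{\tilde x}{\nu}\right)}\,e^{-i\gamma\left(\frac{x_1^2}{\lambda^2}+\frac{|\tilde x|^2}{\nu^2}+\frac{x_n^2}{\nu^2}\right)}\,G\!\left(\frac{\alpha_1\lambda}{2\gamma},\frac{\alpha'\nu}{2\gamma},\gamma\right)d\alpha\,d\gamma, $$ where $\alpha=(\alpha_1,\alpha')\in\mathbb{R}\times\mathbb{R}^{n-2}$, $\gamma\in\mathbb{R}$, and $$G(u,w)=\int_0^\infty\frac{\partial}{\partial t}R_Ef(u,t)\,e^{iwt^2}\,dt,\qquad u\in\mathbb{R}^{n-1},\ w\in\mathbb{R}.$$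
   Context: Write $u=(u_1,\tilde u)\in\mathbb{R}\times\mathbb{R}^{n-2}$ (for $n=2$ the components $\tilde x,\tilde u,\alpha'$ are absent). For $u\in\mathbb{R}^{n-1}$ and $t>0$ let $$E_{u,t}=\Big\{x\in\mathbb{R}^n:\ \frac{(x_1-u_1)^2}{\lambda^2}+\frac{|\tilde x-\tilde u|^2}{\nu^2}+\frac{x_n^2}{\nu^2}\le t^2\Big\}.$$ The elliptical Radon transform is $R_Ef(u,t)=\int_{E_{u,t}}f(x)\,dx$.
   Formalization: The prefactor is corrected to x_n/((2π)^n ν C(λ)), since the printed C(λ)² is off by the factor λν^{n-2}; the integral, not absolutely convergent in general, is read as a Lebesgue integral in α followed by a conditionally convergent integral in γ. *)

theory Defs
  imports "HOL-Analysis.Analysis"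
begin

(* C^m on the whole space: all iterated directional derivatives up to order m exist
   and are continuous. *)
primrec C_diff :: "nat \<Rightarrow> ('a::euclidean_space \<Rightarrow> 'b::real_normed_vector) \<Rightarrow> bool" where
  "C_diff 0 f \<longleftrightarrow> continuous_on UNIV f"
| "C_diff (Suc m) f \<longleftrightarrow> (\<forall>x. f differentiable (at x)) \<and>
     (\<forall>v. C_diff m (\<lambda>x. frechet_derivative f (at x) v))"

definition test_function :: "('a::euclidean_space \<Rightarrow> 'b::real_normed_vector) \<Rightarrow> bool" where
  "test_function f \<longleftrightarrow> (\<forall>m. C_diff m f) \<and> compact (closure {x. f x \<noteq> 0})"

(* The space R^n is (real ^ 'm) * real with n = CARD('m) + 1, so that n = 2 is covered by
   CARD('m) = 1.  The index k :: 'm marks the distinguished first coordinate: for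
   u :: real ^ 'm the component u_1 is u $ k, and the remaining n - 2 components (none if
   n = 2) are the u $ j with j \<noteq> k. *)

definition nu :: "real \<Rightarrow> real" where
  "nu lam = sqrt (lam\<^sup>2 - 1)"

definition semiaxis :: "'m \<Rightarrow> real \<Rightarrow> 'm \<Rightarrow> real" where
  "semiaxis k lam j = (if j = k then lam else nu lam)"

definition ell_form :: "'m::finite \<Rightarrow> real \<Rightarrow> real ^ 'm \<Rightarrow> real \<Rightarrow> real" where
  "ell_form k lam y yn =
     (y $ k)\<^sup>2 / lam\<^sup>2 + (\<Sum>j\<in>UNIV - {k}. (y $ j)\<^sup>2) / (nu lam)\<^sup>2 + yn\<^sup>2 / (nu lam)\<^sup>2"

definition ell :: "'m::finite \<Rightarrow> real \<Rightarrow> real ^ 'm \<Rightarrow> real \<Rightarrow> ((real ^ 'm) \<times> real) set" where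
  "ell k lam u t = {(y, yn). ell_form k lam (y - u) yn \<le> t\<^sup>2}"

definition RE ::
  "'m::finite \<Rightarrow> real \<Rightarrow> ((real ^ 'm) \<times> real \<Rightarrow> complex) \<Rightarrow> real ^ 'm \<Rightarrow> real \<Rightarrow> complex" where
  "RE k lam f u t = (LINT x : ell k lam u t | lborel. f x)"

definition G ::
  "'m::finite \<Rightarrow> real \<Rightarrow> ((real ^ 'm) \<times> real \<Rightarrow> complex) \<Rightarrow> real ^ 'm \<Rightarrow> real \<Rightarrow> complex" where
  "G k lam f u w =
     (LINT t : {0<..} | lborel.
        vector_derivative (RE k lam f u) (at t) * exp (\<i> * complex_of_real (w * t\<^sup>2)))"

(* C n lam is the Jacobian of the dilation (z_1, z~, z_n) \<mapsto> (lam z_1, nu z~, nu z_n) of R^n. *)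
definition C :: "nat \<Rightarrow> real \<Rightarrow> real" where
  "C n lam = lam * nu lam ^ (n - 1)"

(* For a fixed value of gamma \<noteq> 0 this is the integrand of the inversion formula as a
   function of alpha. *)
definition inv_integrand ::
  "'m::finite \<Rightarrow> real \<Rightarrow> ((real ^ 'm) \<times> real \<Rightarrow> complex) \<Rightarrow> real ^ 'm \<Rightarrow> real
     \<Rightarrow> real \<Rightarrow> real ^ 'm \<Rightarrow> complex" where
  "inv_integrand k lam f x xn \<gamma> \<alpha> =
     exp (- \<i> * complex_of_real ((norm \<alpha>)\<^sup>2 / (4 * \<gamma>))) *
     exp (\<i> * complex_of_real (\<alpha> \<bullet> (\<chi> j. x $ j / semiaxis k lam j))) *
     exp (- \<i> * complex_of_real (\<gamma> * ell_form k lam x xn)) *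
     G k lam f (\<chi> j. \<alpha> $ j * semiaxis k lam j / (2 * \<gamma>)) \<gamma>"

(* The integrand is in general not absolutely integrable in (alpha, gamma) jointly: after
   the alpha-integration it decays only like |gamma| powr (-1/2), with an oscillating
   factor, when f does not vanish on x_n = 0.  The double integral is therefore iterated:
   a Lebesgue integral in alpha, then a conditionally convergent integral in gamma, for
   which the gauge integral over UNIV means that the integrals over [a, b] converge as
   a \<rightarrow> -\<infinity> and b \<rightarrow> \<infinity> independently.

   Constant: with x_n = nu z_n and dx = C n lam dz, Fourier inversion in (z', |z|^2) gives
   f x / z_n = (2 pi)^(-n) (C n lam)^(-1) times the integral, hence the prefactor
   x_n / ((2 pi)^n * nu lam * C n lam).  The prefactor x_n / ((2 pi)^n * (C n lam)^2) is
   off by the factor C n lam / nu lam = lam * nu lam ^ (n - 2). *)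

end

theory Submission
  imports Defs "HOL-Probability.Characteristic_Functions" "HOL-Probability.Sinc_Integral"
begin

text \<open>
  The inversion formula is Fourier inversion in disguise.  Let \<open>q\<close> be the quadratic form
  \<open>ell_form k lam\<close>, so that the ellipsoid with centre \<open>u\<close> and radius \<open>t\<close> is the set where
  \<open>q (z - (u, 0)) \<le> t\<^sup>2\<close>.  Differentiating the integral of \<open>f\<close> over it with respect to \<open>t\<close>
  and integrating against \<open>exp (i w t\<^sup>2)\<close> sums \<open>f\<close> over all shells, hence (\<open>G_eq\<close>)
  \<open>G u w = \<integral> f z * exp (i w q (z - (u, 0))) dz\<close>.  This is proved without polar coordinates:
  rescaling to the unit ball shows that integrals over the ellipsoids are differentiable in \<open>t\<close>,
  and an estimate on thin shells shows that a factor \<open>exp (i w q)\<close> in the integrand multiplies the derivative by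
  \<open>exp (i w t\<^sup>2)\<close> (\<open>phase_integral_has_vector_derivative\<close>).

  With \<open>w = \<gamma>\<close> and the centre scaled by \<open>1 / (2 * \<gamma>)\<close>, the square expands into
  \<open>\<gamma> * q z\<close>, a phase that is linear in \<open>\<alpha>\<close>, and a term that the first exponential of
  the integrand cancels.  Writing \<open>\<beta>\<close> for \<open>\<alpha>\<close> divided by the semiaxes, the integrand is thus the
  Fourier transform, in the first variable only, of the test function \<open>f z * exp (i \<gamma> q z)\<close>,
  evaluated at \<open>\<beta>\<close> and multiplied by \<open>exp (i \<beta> \<bullet> x)\<close> and a constant phase (\<open>inv_integrand_eq\<close>).
  Integration by parts shows that this transform decays fast enough to be integrable, and
  Fourier inversion (\<open>partial_fourier_inversion\<close>) evaluates the integral over \<open>\<alpha>\<close> as a constant times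
  \<open>\<integral> f (x, s) * exp (i \<gamma> (s\<^sup>2 - xn\<^sup>2) / \<nu>\<^sup>2) ds\<close>.

  Since \<open>f\<close> is even in the last variable, the integral over \<open>\<gamma>\<close> is a one-dimensional Fourier
  inversion in the variable \<open>s\<^sup>2\<close>, which produces the value of \<open>f (x, s) / s\<close> at \<open>s = xn\<close> and
  therefore the prefactor \<open>xn\<close>.  This integral converges only conditionally in general; its primitive is computed
  explicitly by Dirichlet's argument, as a sine integral plus a term that vanishes at both ends
  (\<open>radial_fourier_inversion\<close>).
\<close>

section \<open>Parameter-dependent integrals\<close>

lemma has_vector_derivative_iff_slope:
  fixes f :: "real \<Rightarrow> 'b::real_normed_vector"
  shows "(f has_vector_derivative D) (at t) \<longleftrightarrow> ((\<lambda>h. (f (t + h) - f t) /\<^sub>R h) \<longlongrightarrow> D) (at 0)"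
proof -
  have "norm (f (t + h) - f t - h *\<^sub>R D) / \<bar>h\<bar> = norm ((f (t + h) - f t) /\<^sub>R h - D)" if "h \<noteq> 0" for h
  proof -
    have "(f (t + h) - f t) /\<^sub>R h - D = (f (t + h) - f t - h *\<^sub>R D) /\<^sub>R h"
      using that by (simp add: algebra_simps)
    then show ?thesis
      by (simp add: divide_inverse)
  qed
  then have "((\<lambda>h. norm (f (t + h) - f t - h *\<^sub>R D) / \<bar>h\<bar>) \<longlongrightarrow> 0) (at 0) \<longleftrightarrow>
             ((\<lambda>h. norm ((f (t + h) - f t) /\<^sub>R h - D)) \<longlongrightarrow> 0) (at 0)"
    by (intro Lim_cong_within) auto
  moreover have "((\<lambda>h. (f (t + h) - f t) /\<^sub>R h) \<longlongrightarrow> D) (at 0) \<longleftrightarrow>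
             ((\<lambda>h. norm ((f (t + h) - f t) /\<^sub>R h - D)) \<longlongrightarrow> 0) (at 0)"
    by (subst Lim_null) (rule tendsto_norm_zero_iff[symmetric])
  ultimately show ?thesis
    unfolding has_vector_derivative_def has_derivative_at
    by (auto intro: bounded_linear_scaleR_left)
qed

text \<open>By the mean value theorem \<open>g\<close> also dominates the difference quotients, so dominated
  convergence applies along every sequence of increments tending to 0.  Measurability of \<open>F' t\<close>
  comes with it, as a pointwise limit of difference quotients.\<close>

lemma has_vector_derivative_integral:
  fixes F F' :: "real \<Rightarrow> 'a \<Rightarrow> 'b::{banach, second_countable_topology}"
  assumes r: "0 < r"
    and int: "\<And>s. \<bar>s - t\<bar> < r \<Longrightarrow> integrable M (F s)"
    and der: "\<And>s x. \<bar>s - t\<bar> < r \<Longrightarrow> x \<in> space M \<Longrightarrow>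
                ((\<lambda>s. F s x) has_vector_derivative F' s x) (at s)"
    and bound: "\<And>s x. \<bar>s - t\<bar> < r \<Longrightarrow> x \<in> space M \<Longrightarrow> norm (F' s x) \<le> g x"
    and g: "integrable M g"
  shows "((\<lambda>s. \<integral>x. F s x \<partial>M) has_vector_derivative (\<integral>x. F' t x \<partial>M)) (at t)"
proof -
  define Q where "Q h x = (F (t + h) x - F t x) /\<^sub>R h" for h x
  have lim: "((\<lambda>h. Q h x) \<longlongrightarrow> F' t x) (at 0)" if "x \<in> space M" for x
  proof -
    have "((\<lambda>s. F s x) has_vector_derivative F' t x) (at t)"
      by (rule der) (use r that in simp_all)
    then show ?thesis
      unfolding Q_def by (simp only: has_vector_derivative_iff_slope)
  qed
  have Qbound: "norm (Q h x) \<le> g x" if "x \<in> space M" "\<bar>h\<bar> < r" "h \<noteq> 0" for x h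
  proof -
    have "norm (F (t + h) x - F t x) \<le> g x * norm (t + h - t)"
    proof (rule differentiable_bound[where S = "ball t r" and f = "\<lambda>s. F s x" and x = "t + h" and y = t and f' = "\<lambda>s u. u *\<^sub>R F' s x"])
      show "((\<lambda>s. F s x) has_derivative (\<lambda>u. u *\<^sub>R F' s x)) (at s within ball t r)"
        if "s \<in> ball t r" for s
      proof (rule has_derivative_at_withinI)
        show "((\<lambda>s. F s x) has_derivative (\<lambda>u. u *\<^sub>R F' s x)) (at s)"
          using der[of s x] that \<open>x \<in> space M\<close>
          by (simp add: has_vector_derivative_def dist_real_def abs_minus_commute)
      qed
      show "onorm (\<lambda>u. u *\<^sub>R F' s x) \<le> g x" if "s \<in> ball t r" for s
      proof (rule onorm_le)
        have "norm (F' s x) \<le> g x"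
          using bound[of s x] that \<open>x \<in> space M\<close> by (simp add: dist_real_def abs_minus_commute)
        then show "norm (u *\<^sub>R F' s x) \<le> g x * norm u" for u
          by (simp add: mult.commute[of "g x"] mult_left_mono)
      qed
      show "t + h \<in> ball t r" "t \<in> ball t r" "convex (ball t r)"
        using that r by (simp_all add: dist_real_def)
    qed
    then show ?thesis
      using that by (simp add: Q_def divide_inverse[symmetric] mult.commute[of "inverse _"] pos_divide_le_eq)
  qed
  have "((\<lambda>h. \<integral>x. Q h x \<partial>M) \<longlongrightarrow> (\<integral>x. F' t x \<partial>M)) (at 0 within ball 0 r)"
    unfolding tendsto_at_iff_sequentially o_def
  proof (intro allI impI)
    fix X :: "nat \<Rightarrow> real"
    assume X: "\<forall>i. X i \<in> ball 0 r - {0}" and X0: "X \<longlonglongrightarrow> 0"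
    have seq: "(\<lambda>i. Q (X i) x) \<longlonglongrightarrow> F' t x" if "x \<in> space M" for x
      using lim[OF that] X X0 unfolding tendsto_at_iff_sequentially o_def by auto
    have meas: "Q (X i) \<in> borel_measurable M" for i
      unfolding Q_def using int[of "t + X i"] int[of t] X r
      by (auto intro!: borel_measurable_diff borel_measurable_scaleR)
    have F'meas: "F' t \<in> borel_measurable M"
      by (rule borel_measurable_LIMSEQ_metric[OF meas seq])
    show "(\<lambda>i. \<integral>x. Q (X i) x \<partial>M) \<longlonglongrightarrow> (\<integral>x. F' t x \<partial>M)"
      by (rule integral_dominated_convergence[OF F'meas meas g])
        (use seq Qbound X in auto)
  qed
  then have "((\<lambda>h. \<integral>x. Q h x \<partial>M) \<longlongrightarrow> (\<integral>x. F' t x \<partial>M)) (at 0)"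
    using r by (simp add: at_within_open[of 0 "ball 0 r"])
  moreover have "\<forall>\<^sub>F h in at 0. (\<integral>x. Q h x \<partial>M) = ((\<integral>x. F (t + h) x \<partial>M) - (\<integral>x. F t x \<partial>M)) /\<^sub>R h"
    using eventually_at_ball[OF r, of 0 UNIV]
  proof eventually_elim
    case (elim h)
    then show ?case
      unfolding Q_def using int[of "t + h"] int[of t] r by (simp add: Bochner_Integration.integral_diff)
  qed
  ultimately show ?thesis
    unfolding has_vector_derivative_iff_slope by (simp cong: tendsto_cong)
qed

lemma continuous_on_integral:
  fixes F :: "'c::metric_space \<Rightarrow> 'a \<Rightarrow> 'b::{banach, second_countable_topology}"
  assumes meas: "\<And>s. s \<in> S \<Longrightarrow> F s \<in> borel_measurable M"
    and cont: "\<And>x. x \<in> space M \<Longrightarrow> continuous_on S (\<lambda>s. F s x)"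
    and bound: "\<And>s x. s \<in> S \<Longrightarrow> x \<in> space M \<Longrightarrow> norm (F s x) \<le> g x"
    and g: "integrable M g"
  shows "continuous_on S (\<lambda>s. \<integral>x. F s x \<partial>M)"
proof (rule continuous_on_sequentiallyI)
  fix u a assume u: "\<forall>n. u n \<in> S" "a \<in> S" "u \<longlonglongrightarrow> a"
  have "(\<lambda>n. F (u n) x) \<longlonglongrightarrow> F a x" if "x \<in> space M" for x
    using cont[OF that] u by (auto simp: continuous_on_sequentially o_def)
  then show "(\<lambda>n. \<integral>x. F (u n) x \<partial>M) \<longlonglongrightarrow> (\<integral>x. F a x \<partial>M)"
    using u meas bound
    by (intro integral_dominated_convergence[where s = "\<lambda>n. F (u n)" and w = g] g) auto
qed

section \<open>Smooth and compactly supported functions\<close>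

lemma C_diff_SucI:
  assumes "\<And>x. (f has_derivative (\<lambda>v. D v x)) (at x)" "\<And>v. C_diff m (D v)"
  shows "C_diff (Suc m) f"
proof -
  have "frechet_derivative f (at x) = (\<lambda>v. D v x)" for x
    using frechet_derivative_at[OF assms(1)] by simp
  then show ?thesis
    using assms by (auto simp: differentiable_def)
qed

lemma C_diff_has_derivative:
  "C_diff (Suc m) f \<Longrightarrow> (f has_derivative frechet_derivative f (at x)) (at x)"
  by (simp add: frechet_derivative_works)

lemma C_diff_frechet:
  "C_diff (Suc m) f \<Longrightarrow> C_diff m (\<lambda>x. frechet_derivative f (at x) v)"
  by simp

lemma C_diff_continuous: "C_diff m f \<Longrightarrow> continuous_on UNIV f"
  by (cases m) (auto intro!: differentiable_imp_continuous_on simp: differentiable_on_def)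

lemma C_diff_SucD: "C_diff (Suc m) f \<Longrightarrow> C_diff m f"
proof (induction m arbitrary: f)
  case 0
  show ?case using C_diff_continuous[OF 0] by simp
next
  case (Suc m)
  have "C_diff (Suc m) (\<lambda>x. frechet_derivative f (at x) v)" for v
    by (rule C_diff_frechet[OF Suc.prems])
  then have "C_diff m (\<lambda>x. frechet_derivative f (at x) v)" for v
    by (rule Suc.IH)
  then show ?case
    using Suc.prems by auto
qed

lemma C_diff_diff: "C_diff m f \<Longrightarrow> C_diff m g \<Longrightarrow> C_diff m (\<lambda>x. f x - g x)"
proof (induction m arbitrary: f g)
  case 0 then show ?case by (auto intro: continuous_on_diff)
next
  case (Suc m)
  show ?case
    by (rule C_diff_SucI[OF has_derivative_diff[OF Suc.prems[THEN C_diff_has_derivative]]])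
      (intro Suc.IH Suc.prems[THEN C_diff_frechet])
qed

lemma C_diff_add: "C_diff m f \<Longrightarrow> C_diff m g \<Longrightarrow> C_diff m (\<lambda>x. f x + g x)"
proof (induction m arbitrary: f g)
  case 0 then show ?case by (auto intro: continuous_on_add)
next
  case (Suc m)
  show ?case
    by (rule C_diff_SucI[OF has_derivative_add[OF Suc.prems[THEN C_diff_has_derivative]]])
      (intro Suc.IH Suc.prems[THEN C_diff_frechet])
qed

lemma C_diff_mult:
  fixes f g :: "'a::euclidean_space \<Rightarrow> 'b::real_normed_algebra"
  shows "C_diff m f \<Longrightarrow> C_diff m g \<Longrightarrow> C_diff m (\<lambda>x. f x * g x)"
proof (induction m arbitrary: f g)
  case 0 then show ?case by (auto intro: continuous_on_mult)
next
  case (Suc m)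
  show ?case
    by (rule C_diff_SucI[OF has_derivative_mult[OF Suc.prems[THEN C_diff_has_derivative]]])
      (intro C_diff_add Suc.IH Suc.prems[THEN C_diff_frechet] Suc.prems[THEN C_diff_SucD])
qed

lemma C_diff_const: "C_diff m (\<lambda>x. c)"
proof (induction m arbitrary: c)
  case (Suc m)
  show ?case by (rule C_diff_SucI[OF has_derivative_const]) (rule Suc)
qed simp

lemma C_diff_bounded_linear: "bounded_linear f \<Longrightarrow> C_diff m f"
proof (cases m)
  case 0
  then show "bounded_linear f \<Longrightarrow> C_diff m f" by (simp add: linear_continuous_on)
next
  case (Suc k)
  then show "bounded_linear f \<Longrightarrow> C_diff m f"
    by (simp only:) (rule C_diff_SucI[OF bounded_linear_imp_has_derivative C_diff_const], assumption)
qed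

text \<open>Differentiating an imaginary exponential reproduces it, times the derivative of its phase, so the
  exponential is as smooth as that derivative allows; this drives an induction on the order.\<close>

lemma C_diff_iexp:
  assumes q: "\<And>x. (q has_derivative (\<lambda>v. B v x)) (at x)" and B: "\<And>m v. C_diff m (\<lambda>x. complex_of_real (B v x))"
  shows "C_diff m (\<lambda>x::'a::euclidean_space. exp (\<i> * complex_of_real (w * q x)))"
proof (induction m)
  case 0
  have "continuous_on UNIV q"
    by (rule has_derivative_continuous_on[of UNIV q "\<lambda>x v. B v x"]) (rule q)
  then show ?case by (auto intro!: continuous_intros)
next
  case (Suc m)
  have "((\<lambda>x. exp (\<i> * complex_of_real (w * q x))) has_derivative
        (\<lambda>v. exp (\<i> * complex_of_real (w * q x)) * (\<i> * complex_of_real (w * B v x)))) (at x)" for x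
  proof -
    have "((\<lambda>x. \<i> * complex_of_real (w * q x)) has_derivative (\<lambda>v. \<i> * complex_of_real (w * B v x))) (at x)"
      by (intro has_derivative_mult_right has_derivative_of_real q)
    from has_derivative_compose[OF this DERIV_exp[unfolded has_field_derivative_def]]
    show ?thesis .
  qed
  moreover have "C_diff m (\<lambda>x. exp (\<i> * complex_of_real (w * q x)) * (\<i> * complex_of_real (w * B v x)))" for v
  proof (rule C_diff_mult[OF Suc])
    show "C_diff m (\<lambda>x. \<i> * complex_of_real (w * B v x))"
      using C_diff_mult[OF C_diff_const[of _ "\<i> * complex_of_real w"] B] by (simp add: mult.assoc)
  qed
  ultimately show ?case
    by (rule C_diff_SucI)
qed

lemma test_function_C_diff: "test_function f \<Longrightarrow> C_diff m f"
  by (simp add: test_function_def)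

lemma test_function_continuous: "test_function f \<Longrightarrow> continuous_on UNIV f"
  using test_function_C_diff[of f 0] by simp

lemma test_function_has_derivative:
  "test_function f \<Longrightarrow> (f has_derivative frechet_derivative f (at x)) (at x)"
  by (rule C_diff_has_derivative[OF test_function_C_diff])

lemma test_function_subset_support:
  assumes f: "test_function f" and g: "\<And>m. C_diff m g" and "\<And>x. x \<notin> closure {x. f x \<noteq> 0} \<Longrightarrow> g x = 0"
  shows "test_function g"
proof -
  have "closure {x. g x \<noteq> 0} \<subseteq> closure {x. f x \<noteq> 0}"
    using assms(3) by (intro closure_minimal) auto
  then have "compact (closure {x. g x \<noteq> 0})"
    using f bounded_subset unfolding test_function_def compact_eq_bounded_closed by blast
  then show ?thesis
    using g by (simp add: test_function_def)
qed

lemma test_function_frechet: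
  assumes f: "test_function f"
  shows "test_function (\<lambda>x. frechet_derivative f (at x) v)"
proof (rule test_function_subset_support[OF f])
  show "C_diff m (\<lambda>x. frechet_derivative f (at x) v)" for m
    by (rule C_diff_frechet[OF test_function_C_diff[OF f]])
  fix x assume x: "x \<notin> closure {x. f x \<noteq> 0}"
  have "(f has_derivative (\<lambda>v. 0)) (at x)"
  proof (rule has_derivative_transform_within_open[where s = "- closure {x. f x \<noteq> 0}" and f = "\<lambda>x. 0"])
    show "0 = f y" if "y \<in> - closure {x. f x \<noteq> 0}" for y
      using that closure_subset[of "{x. f x \<noteq> 0}"] by auto
  qed (use x in auto)
  from frechet_derivative_at[OF this] show "frechet_derivative f (at x) v = 0"
    by (simp add: fun_eq_iff)
qed

lemma test_function_mult:
  fixes f g :: "'a::euclidean_space \<Rightarrow> 'b::real_normed_algebra"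
  assumes f: "test_function f" and g: "\<And>m. C_diff m g"
  shows "test_function (\<lambda>x. f x * g x)"
proof (rule test_function_subset_support[OF f])
  show "C_diff m (\<lambda>x. f x * g x)" for m
    by (intro C_diff_mult test_function_C_diff[OF f] g)
  show "f x * g x = 0" if "x \<notin> closure {x. f x \<noteq> 0}" for x
  proof -
    have "f x = 0"
      using that closure_subset[of "{x. f x \<noteq> 0}"] by auto
    then show ?thesis by simp
  qed
qed

lemma test_function_bounded_support:
  assumes "test_function f"
  obtains r where "r > 0" "\<And>x. f x \<noteq> 0 \<Longrightarrow> norm x \<le> r"
proof -
  have "bounded (closure {x. f x \<noteq> 0})"
    using assms by (auto simp: test_function_def compact_imp_bounded)
  then obtain r where "\<forall>x\<in>closure {x. f x \<noteq> 0}. norm x \<le> r"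
    by (auto simp: bounded_iff)
  then show ?thesis
    using subsetD[OF closure_subset, of _ "{x. f x \<noteq> 0}"]
    by (intro that[of "max r 1"]) (auto intro: max.coboundedI1)
qed

lemma test_function_diff:
  assumes f: "test_function f" and g: "test_function g"
  shows "test_function (\<lambda>x. f x - g x)"
proof -
  have "closure {x. f x - g x \<noteq> 0} \<subseteq> closure ({x. f x \<noteq> 0} \<union> {x. g x \<noteq> 0})"
    by (intro closure_mono) auto
  then have "compact (closure {x. f x - g x \<noteq> 0})"
    using f g bounded_subset[of "closure {x. f x \<noteq> 0} \<union> closure {x. g x \<noteq> 0}"]
    unfolding test_function_def closure_Un compact_eq_bounded_closed by simp
  then show ?thesis
    using f g by (auto simp: test_function_def intro: C_diff_diff)
qed

lemma test_function_integrable: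
  fixes f :: "'a::euclidean_space \<Rightarrow> 'b::{banach, second_countable_topology}"
  assumes f: "test_function f"
  shows "integrable lborel f"
proof -
  have "integrable lborel (\<lambda>x. indicator (closure {x. f x \<noteq> 0}) x *\<^sub>R f x)"
    using f continuous_on_subset[OF test_function_continuous[OF f]]
    by (intro borel_integrable_compact) (auto simp: test_function_def)
  also have "(\<lambda>x. indicator (closure {x. f x \<noteq> 0}) x *\<^sub>R f x) = f"
    using closure_subset[of "{x. f x \<noteq> 0}"] by (auto simp: indicator_def fun_eq_iff)
  finally show ?thesis .
qed

lemma test_function_bounded:
  fixes f :: "'a::euclidean_space \<Rightarrow> 'b::real_normed_vector"
  assumes f: "test_function f"
  obtains M where "M \<ge> 0" "\<And>x. norm (f x) \<le> M"
proof -
  obtain r where r: "r > 0" "\<And>x. f x \<noteq> 0 \<Longrightarrow> norm x \<le> r"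
    using test_function_bounded_support[OF f] by blast
  have "compact (f ` cball 0 r)"
    by (intro compact_continuous_image continuous_on_subset[OF test_function_continuous[OF f]]) auto
  then obtain B where B: "\<forall>y\<in>f ` cball 0 r. norm y \<le> B"
    using compact_imp_bounded bounded_iff by blast
  have "norm (f x) \<le> max B 0" for x
    using B r(2)[of x] by (cases "f x = 0") (auto intro: max.coboundedI1)
  then show ?thesis
    using that[of "max B 0"] by auto
qed

lemma linear_Basis_expansion:
  fixes y :: "'a::euclidean_space"
  assumes "linear L"
  shows "L y = (\<Sum>b\<in>Basis. (y \<bullet> b) *\<^sub>R L b)"
  using linear_sum[OF assms, of "\<lambda>b. (y \<bullet> b) *\<^sub>R b" Basis]
  by (simp add: euclidean_representation linear_scale[OF assms])

text \<open>Expanding the direction in the basis leaves finitely many directional derivatives, and each of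
  them is a test function, hence bounded.\<close>

lemma test_function_frechet_bounded:
  fixes f :: "'a::euclidean_space \<Rightarrow> 'b::real_normed_vector"
  assumes f: "test_function f"
  obtains M where "M \<ge> 0" "\<And>x v. norm (frechet_derivative f (at x) v) \<le> M * norm v"
proof -
  have "\<exists>M\<ge>0. \<forall>x. norm (frechet_derivative f (at x) b) \<le> M" for b
    by (rule test_function_bounded[OF test_function_frechet[OF f, of b]]) blast
  then obtain M where M: "\<And>b. M b \<ge> 0" "\<And>b x. norm (frechet_derivative f (at x) b) \<le> M b"
    by metis
  have "norm (frechet_derivative f (at x) v) \<le> (\<Sum>b\<in>Basis. M b) * norm v" for x v
  proof -
    have "linear (frechet_derivative f (at x))"
      using has_derivative_linear[OF test_function_has_derivative[OF f]] .
    then have "norm (frechet_derivative f (at x) v) = norm (\<Sum>b\<in>Basis. (v \<bullet> b) *\<^sub>R frechet_derivative f (at x) b)"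
      by (subst linear_Basis_expansion) auto
    also have "\<dots> \<le> (\<Sum>b\<in>Basis. norm v * M b)"
      by (intro sum_norm_le) (auto intro!: mult_mono M Basis_le_norm)
    finally show ?thesis
      by (simp add: sum_distrib_left mult.commute)
  qed
  then show ?thesis
    using M(1) by (intro that[of "\<Sum>b\<in>Basis. M b"]) (auto intro: sum_nonneg)
qed

lemma test_function_line_derivative:
  assumes f: "test_function f"
  shows "((\<lambda>s. f (a + s *\<^sub>R z)) has_vector_derivative frechet_derivative f (at (a + s *\<^sub>R z)) z) (at s)"
proof -
  have "((\<lambda>s. a + s *\<^sub>R z) has_derivative (\<lambda>h. h *\<^sub>R z)) (at s)"
    by (auto intro!: derivative_eq_intros)
  from has_derivative_compose[OF this test_function_has_derivative[OF f]]
  show ?thesis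
    using linear_scale[OF has_derivative_linear[OF test_function_has_derivative[OF f]]]
    by (simp add: has_vector_derivative_def)
qed

text \<open>The derivative is linear in the direction, so an expansion in the basis reduces joint continuity
  to the continuity of finitely many directional derivatives.\<close>

lemma test_function_frechet_continuous:
  fixes f :: "'a::euclidean_space \<Rightarrow> 'b::real_normed_vector"
  assumes f: "test_function f" and g: "continuous_on S g" and h: "continuous_on S h"
  shows "continuous_on S (\<lambda>s. frechet_derivative f (at (g s)) (h s))"
proof -
  have "linear (frechet_derivative f (at x))" for x
    using has_derivative_linear[OF test_function_has_derivative[OF f]] .
  then have eq: "frechet_derivative f (at (g s)) (h s) =
        (\<Sum>b\<in>Basis. (h s \<bullet> b) *\<^sub>R frechet_derivative f (at (g s)) b)" for s
    by (rule linear_Basis_expansion)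
  have "continuous_on S (\<lambda>s. frechet_derivative f (at (g s)) b)" for b
    using continuous_on_compose2[OF test_function_continuous[OF test_function_frechet[OF f]] g] by auto
  then show ?thesis
    unfolding eq using h by (intro continuous_intros) auto
qed

section \<open>Affine changes of variables\<close>

lemma
  fixes g :: "'a::euclidean_space \<Rightarrow> 'b::{banach, second_countable_topology}" and c :: "'a \<Rightarrow> real"
  assumes g [measurable]: "g \<in> borel_measurable borel" and c: "\<And>j. j \<in> Basis \<Longrightarrow> c j \<noteq> 0"
  shows lborel_integral_affine_euclidean:
      "(\<integral>x. g x \<partial>lborel) =
       (\<Prod>j\<in>Basis. \<bar>c j\<bar>) *\<^sub>R (\<integral>x. g (a + (\<Sum>j\<in>Basis. (c j * (x \<bullet> j)) *\<^sub>R j)) \<partial>lborel)"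
    and lborel_integrable_affine_euclidean:
      "integrable lborel (\<lambda>x. g (a + (\<Sum>j\<in>Basis. (c j * (x \<bullet> j)) *\<^sub>R j))) \<Longrightarrow> integrable lborel g"
proof -
  let ?T = "\<lambda>x::'a. a + (\<Sum>j\<in>Basis. (c j * (x \<bullet> j)) *\<^sub>R j)"
  let ?p = "\<Prod>j\<in>Basis. \<bar>c j\<bar>"
  have eq: "lborel = density (distr lborel borel ?T) (\<lambda>_. ennreal ?p)"
    using lborel_affine_euclidean[OF c, of "\<lambda>j. j" a] by simp
  have p: "0 \<le> ?p"
    by (rule prod_nonneg) simp
  have "(\<integral>x. g x \<partial>lborel) = integral\<^sup>L (density (distr lborel borel ?T) (\<lambda>_. ennreal ?p)) g"
    using eq by simp
  also have "\<dots> = (\<integral>x. ?p *\<^sub>R g x \<partial>distr lborel borel ?T)"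
    by (rule integral_density) (use p in auto)
  also have "\<dots> = (\<integral>x. ?p *\<^sub>R g (?T x) \<partial>lborel)"
    by (rule integral_distr) auto
  finally show "(\<integral>x. g x \<partial>lborel) = ?p *\<^sub>R (\<integral>x. g (?T x) \<partial>lborel)"
    by simp
  assume "integrable lborel (\<lambda>x. g (?T x))"
  then have "integrable (distr lborel borel ?T) (\<lambda>x. ?p *\<^sub>R g x)"
    by (subst integrable_distr_eq) auto
  then have "integrable (density (distr lborel borel ?T) (\<lambda>_. ennreal ?p)) g"
    by (subst integrable_density) (use p in auto)
  then show "integrable lborel g"
    using eq by simp
qed

lemma
  fixes g :: "'a::euclidean_space \<Rightarrow> 'b::{banach, second_countable_topology}"
  assumes g: "g \<in> borel_measurable borel" and c: "c \<noteq> 0"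
  shows lborel_integral_affine:
      "(\<integral>x. g x \<partial>lborel) = \<bar>c\<bar> ^ DIM('a) *\<^sub>R (\<integral>x. g (a + c *\<^sub>R x) \<partial>lborel)"
    and lborel_integrable_affine:
      "integrable lborel (\<lambda>x. g (a + c *\<^sub>R x)) \<Longrightarrow> integrable lborel g"
proof -
  have eq: "(\<Sum>j\<in>Basis. (c * (x \<bullet> j)) *\<^sub>R j) = c *\<^sub>R x" for x :: 'a
    by (simp only: scaleR_scaleR[symmetric] scaleR_sum_right[symmetric] euclidean_representation)
  show "(\<integral>x. g x \<partial>lborel) = \<bar>c\<bar> ^ DIM('a) *\<^sub>R (\<integral>x. g (a + c *\<^sub>R x) \<partial>lborel)"
    using lborel_integral_affine_euclidean[OF g, of "\<lambda>_. c" a] c eq by simp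
  show "integrable lborel (\<lambda>x. g (a + c *\<^sub>R x)) \<Longrightarrow> integrable lborel g"
    using lborel_integrable_affine_euclidean[OF g, of "\<lambda>_. c" a] c eq by simp
qed

section \<open>Integrals over the sublevel sets of a quadratic gauge\<close>

lemma norm_iexp_diff_le: "norm (iexp x - iexp y) \<le> \<bar>x - y\<bar>"
proof -
  have "iexp x - iexp y = iexp y * (iexp (x - y) - 1)"
    by (simp add: algebra_simps exp_diff exp_minus divide_inverse)
  then have "norm (iexp x - iexp y) = norm (iexp (x - y) - 1)"
    by (simp add: norm_mult)
  also have "\<dots> \<le> \<bar>x - y\<bar>"
    using iexp_approx1[of "x - y" 0] by simp
  finally show ?thesis .
qed

text \<open>The solid ellipsoids centred at \<open>a\<close> are the sublevel sets of \<open>q (z - a)\<close> for a positive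
  definite quadratic form \<open>q\<close>.  Of the form only three properties enter: continuity,
  homogeneity of degree 2, which allows rescaling, and a lower bound, which keeps the balls bounded.\<close>

locale quadratic_gauge =
  fixes q :: "'a::euclidean_space \<Rightarrow> real" and c0 :: real
  assumes q_cont: "continuous_on UNIV q"
    and q_scale: "q (t *\<^sub>R z) = t\<^sup>2 * q z"
    and c0_pos: "c0 > 0"
    and q_ge: "c0 * (norm z)\<^sup>2 \<le> q z"
begin

definition gball :: "'a \<Rightarrow> real \<Rightarrow> 'a set" where
  "gball a t = {z. q (z - a) \<le> t\<^sup>2}"

definition vol :: real where "vol = measure lborel (gball 0 1)"

lemma q_borel [measurable]: "q \<in> borel_measurable borel"
  using q_cont by (rule borel_measurable_continuous_onI)

lemma gball_sets [measurable]: "gball a t \<in> sets borel"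
  unfolding gball_def by measurable

lemma gball_bounded: "bounded (gball a t)"
proof -
  have "norm (z - a) \<le> \<bar>t\<bar> / sqrt c0" if "z \<in> gball a t" for z
  proof -
    have "c0 * (norm (z - a))\<^sup>2 \<le> t\<^sup>2"
      using that q_ge[of "z - a"] by (simp add: gball_def)
    then have "(norm (z - a))\<^sup>2 \<le> (\<bar>t\<bar> / sqrt c0)\<^sup>2"
      using c0_pos by (simp add: power_divide field_simps)
    then show ?thesis
      by (rule power2_le_imp_le) (use c0_pos in simp)
  qed
  then have "gball a t \<subseteq> cball a (\<bar>t\<bar> / sqrt c0)"
    by (auto simp: dist_norm norm_minus_commute)
  then show ?thesis
    by (rule bounded_subset[OF bounded_cball])
qed

lemma gball_emeasure_finite: "emeasure lborel (gball a t) < \<infinity>"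
  by (rule emeasure_bounded_finite[OF gball_bounded])

lemma gball_mono: "0 \<le> s \<Longrightarrow> s \<le> t \<Longrightarrow> gball a s \<subseteq> gball a t"
  by (auto simp: gball_def intro: order_trans power_mono)

lemma gball_affine: "t \<noteq> 0 \<Longrightarrow> a + t *\<^sub>R z \<in> gball a t \<longleftrightarrow> z \<in> gball 0 1"
  by (simp add: gball_def q_scale)

lemma gball_integral_affine:
  fixes g :: "'a \<Rightarrow> 'b::{banach, second_countable_topology}"
  assumes [measurable]: "g \<in> borel_measurable borel" and t: "t > 0"
  shows "(LINT z:gball a t|lborel. g z) = t ^ DIM('a) *\<^sub>R (LINT z:gball 0 1|lborel. g (a + t *\<^sub>R z))"
proof -
  have "(LINT z:gball a t|lborel. g z) =
     \<bar>t\<bar> ^ DIM('a) *\<^sub>R (LINT z|lborel. indicator (gball a t) (a + t *\<^sub>R z) *\<^sub>R g (a + t *\<^sub>R z))"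
    unfolding set_lebesgue_integral_def by (rule lborel_integral_affine) (use t in auto)
  also have "(\<lambda>z. indicator (gball a t) (a + t *\<^sub>R z) *\<^sub>R g (a + t *\<^sub>R z)) =
             (\<lambda>z. indicator (gball 0 1) z *\<^sub>R g (a + t *\<^sub>R z))"
    using t by (auto simp: fun_eq_iff indicator_def gball_affine)
  finally show ?thesis
    using t by (simp add: set_lebesgue_integral_def)
qed

text \<open>For positive radius this is a change of variables.  The ball of radius 0 is contained in all
  balls of positive radius, so its measure is at most the limit of theirs, which is 0.\<close>

lemma measure_gball:
  assumes "t \<ge> 0"
  shows "measure lborel (gball a t) = t ^ DIM('a) * vol"
proof -
  have pos: "measure lborel (gball a t) = t ^ DIM('a) * vol" if "t > 0" for t
    using gball_integral_affine[of "\<lambda>_. 1::real" t a] that gball_emeasure_finite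
    by (simp add: set_lebesgue_integral_def vol_def)
  have "measure lborel (gball a 0) \<le> 0"
  proof (rule tendsto_lowerbound)
    show "((\<lambda>t. t ^ DIM('a) * vol) \<longlongrightarrow> 0) (at_right 0)"
      by (auto intro!: tendsto_eq_intros simp: zero_power)
    show "\<forall>\<^sub>F t in at_right 0. measure lborel (gball a 0) \<le> t ^ DIM('a) * vol"
      using eventually_at_right_less[of "0::real"]
    proof eventually_elim
      case (elim t)
      have "measure lborel (gball a 0) \<le> measure lborel (gball a t)"
        using elim gball_emeasure_finite by (intro measure_mono_fmeasurable gball_mono fmeasurableI) auto
      then show ?case
        using pos[OF elim] by simp
    qed
  qed auto
  then have "measure lborel (gball a 0) = 0"
    using measure_nonneg[of lborel "gball a 0"] by linarith
  then show ?thesis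
    using pos[of t] assms by (cases "t = 0") auto
qed

lemma gball_shell_bound:
  fixes g :: "'a \<Rightarrow> 'b::{banach, second_countable_topology}"
  assumes g: "integrable lborel g" and st: "0 \<le> s" "s \<le> t"
    and b: "\<And>z. z \<in> gball a t - gball a s \<Longrightarrow> norm (g z) \<le> b"
  shows "norm ((LINT z:gball a t|lborel. g z) - (LINT z:gball a s|lborel. g z)) \<le> b * (vol * (t ^ DIM('a) - s ^ DIM('a)))"
proof -
  have [measurable]: "g \<in> borel_measurable borel"
    using g by auto
  have int: "integrable lborel (\<lambda>z. indicator (gball a u) z *\<^sub>R g z)" for u
    by (rule integrable_mult_indicator[OF _ g]) simp
  have eq: "(LINT z:gball a t|lborel. g z) - (LINT z:gball a s|lborel. g z) =
        (LINT z|lborel. indicator (gball a t) z *\<^sub>R g z - indicator (gball a s) z *\<^sub>R g z)"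
    unfolding set_lebesgue_integral_def by (rule Bochner_Integration.integral_diff[symmetric, OF int int])
  have "norm (\<dots>) \<le> (LINT z|lborel. b * (indicator (gball a t) z - indicator (gball a s) z))"
  proof (rule Bochner_Integration.integral_norm_bound_integral)
    show "integrable lborel (\<lambda>z. indicator (gball a t) z *\<^sub>R g z - indicator (gball a s) z *\<^sub>R g z)"
      using int by (rule Bochner_Integration.integrable_diff[OF _ int])
    show "integrable lborel (\<lambda>z. b * (indicator (gball a t) z - indicator (gball a s) z))"
      using gball_emeasure_finite by (intro integrable_mult_right Bochner_Integration.integrable_diff integrable_real_indicator) auto
    fix z
    show "norm (indicator (gball a t) z *\<^sub>R g z - indicator (gball a s) z *\<^sub>R g z)
          \<le> b * (indicator (gball a t) z - indicator (gball a s) z)"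
      using b[of z] gball_mono[OF st, of a] by (auto simp: indicator_def)
  qed
  also have "\<dots> = b * (measure lborel (gball a t) - measure lborel (gball a s))"
    using gball_emeasure_finite
    by (simp add: Bochner_Integration.integral_diff integrable_real_indicator)
  also have "\<dots> = b * (vol * (t ^ DIM('a) - s ^ DIM('a)))"
    using st by (simp add: measure_gball algebra_simps)
  finally show ?thesis
    using eq by simp
qed

text \<open>A form of the shell estimate for radii in either order, with the shell described by the values
  that \<open>q\<close> takes on it.\<close>

lemma gball_shell_bound_abs:
  fixes g :: "'a \<Rightarrow> 'b::{banach, second_countable_topology}"
  assumes g: "integrable lborel g" and st: "0 \<le> s" "0 \<le> t"
    and b: "\<And>z. \<bar>q (z - a) - t\<^sup>2\<bar> \<le> \<bar>s\<^sup>2 - t\<^sup>2\<bar> \<Longrightarrow> norm (g z) \<le> b"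
  shows "norm ((LINT z:gball a s|lborel. g z) - (LINT z:gball a t|lborel. g z)) \<le> b * (vol * \<bar>s ^ DIM('a) - t ^ DIM('a)\<bar>)"
proof (cases "s \<le> t")
  case True
  have "norm ((LINT z:gball a t|lborel. g z) - (LINT z:gball a s|lborel. g z)) \<le> b * (vol * (t ^ DIM('a) - s ^ DIM('a)))"
    by (rule gball_shell_bound[OF g st(1) True], rule b) (auto simp: gball_def abs_if)
  moreover have "s ^ DIM('a) \<le> t ^ DIM('a)"
    by (rule power_mono) fact+
  ultimately show ?thesis
    by (simp add: norm_minus_commute)
next
  case False
  have "norm ((LINT z:gball a s|lborel. g z) - (LINT z:gball a t|lborel. g z)) \<le> b * (vol * (s ^ DIM('a) - t ^ DIM('a)))"
    by (rule gball_shell_bound[OF g st(2)], use False in simp, rule b) (auto simp: gball_def abs_if)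
  moreover have "t ^ DIM('a) \<le> s ^ DIM('a)"
    by (rule power_mono) (use False st in auto)
  ultimately show ?thesis
    by simp
qed

text \<open>Rescaling to the unit ball moves the radius from the domain of integration into the argument of
  \<open>f\<close>, where differentiation under the integral sign is possible.\<close>

definition dilated_integral :: "('a \<Rightarrow> complex) \<Rightarrow> 'a \<Rightarrow> real \<Rightarrow> complex" where
  "dilated_integral f a t = (LINT z:gball 0 1|lborel. f (a + t *\<^sub>R z))"

definition dilated_integral_deriv :: "('a \<Rightarrow> complex) \<Rightarrow> 'a \<Rightarrow> real \<Rightarrow> complex" where
  "dilated_integral_deriv f a t = (LINT z:gball 0 1|lborel. frechet_derivative f (at (a + t *\<^sub>R z)) z)"

lemma dilated_integrand_measurable:
  assumes f: "test_function f"
  shows "(\<lambda>z. f (a + t *\<^sub>R z)) \<in> borel_measurable borel"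
    and "(\<lambda>z. frechet_derivative f (at (a + t *\<^sub>R z)) z) \<in> borel_measurable borel"
proof -
  have c: "continuous_on UNIV (\<lambda>z. a + t *\<^sub>R z)"
    by (intro continuous_intros)
  show "(\<lambda>z. f (a + t *\<^sub>R z)) \<in> borel_measurable borel"
    by (rule borel_measurable_continuous_onI)
      (rule continuous_on_compose2[OF test_function_continuous[OF f] c], simp)
  show "(\<lambda>z. frechet_derivative f (at (a + t *\<^sub>R z)) z) \<in> borel_measurable borel"
    by (rule borel_measurable_continuous_onI)
      (rule test_function_frechet_continuous[OF f c continuous_on_id])
qed

lemma integrable_gball_bounded: "integrable lborel (\<lambda>z. indicator (gball a t) z * (M::real))"
  using gball_emeasure_finite by (intro integrable_mult_left integrable_real_indicator) auto

lemma
  assumes f: "test_function f"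
  shows dilated_integral_has_vector_derivative: "(dilated_integral f a has_vector_derivative dilated_integral_deriv f a t) (at t)"
    and dilated_integral_deriv_continuous: "continuous_on UNIV (dilated_integral_deriv f a)"
proof -
  obtain M where M: "M \<ge> 0" "\<And>x. norm (f x) \<le> M"
    using test_function_bounded[OF f] by blast
  obtain M' where M': "M' \<ge> 0" "\<And>x v. norm (frechet_derivative f (at x) v) \<le> M' * norm v"
    using test_function_frechet_bounded[OF f] by blast
  obtain \<rho> where \<rho>: "\<And>z. z \<in> gball 0 1 \<Longrightarrow> norm z \<le> \<rho>"
    using gball_bounded[of 0 1] by (auto simp: bounded_iff)
  have [measurable]: "(\<lambda>z. f (a + t *\<^sub>R z)) \<in> borel_measurable borel"
    "(\<lambda>z. frechet_derivative f (at (a + t *\<^sub>R z)) z) \<in> borel_measurable borel" for t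
    using dilated_integrand_measurable[OF f] by auto
  have bound': "norm (indicator (gball 0 1) z *\<^sub>R frechet_derivative f (at (a + t *\<^sub>R z)) z)
      \<le> indicator (gball 0 1) z * (M' * \<rho>)" for z t
    using M'(2)[of "a + t *\<^sub>R z" z] mult_left_mono[OF \<rho> M'(1), of z] by (auto simp: indicator_def)
  show "(dilated_integral f a has_vector_derivative dilated_integral_deriv f a t) (at t)"
    unfolding dilated_integral_def[abs_def] dilated_integral_deriv_def set_lebesgue_integral_def
  proof (rule has_vector_derivative_integral[where r = 1 and g = "\<lambda>z. indicator (gball 0 1) z * (M' * \<rho>)"])
    fix s
    show "integrable lborel (\<lambda>z. indicator (gball 0 1) z *\<^sub>R f (a + s *\<^sub>R z))"
      by (rule Bochner_Integration.integrable_bound[OF integrable_gball_bounded[of 0 1 M]])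
        (use M in \<open>auto simp: indicator_def\<close>)
    show "((\<lambda>s. indicator (gball 0 1) z *\<^sub>R f (a + s *\<^sub>R z)) has_vector_derivative
        indicator (gball 0 1) z *\<^sub>R frechet_derivative f (at (a + s *\<^sub>R z)) z) (at s)" for z
      by (rule bounded_linear.has_vector_derivative[OF bounded_linear_scaleR_right test_function_line_derivative[OF f]])
  qed (use bound' integrable_gball_bounded in auto)
  show "continuous_on UNIV (dilated_integral_deriv f a)"
    unfolding dilated_integral_deriv_def[abs_def] set_lebesgue_integral_def
  proof (rule continuous_on_integral[where g = "\<lambda>z. indicator (gball 0 1) z * (M' * \<rho>)"])
    show "continuous_on UNIV (\<lambda>s. indicator (gball 0 1) z *\<^sub>R frechet_derivative f (at (a + s *\<^sub>R z)) z)" for z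
      by (intro continuous_intros test_function_frechet_continuous[OF f])
  qed (use bound' integrable_gball_bounded in auto)
qed

definition phase_integral :: "('a \<Rightarrow> complex) \<Rightarrow> 'a \<Rightarrow> real \<Rightarrow> real \<Rightarrow> complex" where
  "phase_integral f a w t = (LINT z:gball a t|lborel. f z * iexp (w * q (z - a)))"

definition ball_integral_deriv :: "('a \<Rightarrow> complex) \<Rightarrow> 'a \<Rightarrow> real \<Rightarrow> complex" where
  "ball_integral_deriv f a t = (real DIM('a) * t ^ (DIM('a) - 1)) *\<^sub>R dilated_integral f a t + t ^ DIM('a) *\<^sub>R dilated_integral_deriv f a t"

lemma ball_integral_deriv_continuous: "test_function f \<Longrightarrow> continuous_on UNIV (ball_integral_deriv f a)"
  unfolding ball_integral_deriv_def[abs_def]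
  by (intro continuous_intros dilated_integral_deriv_continuous continuous_at_imp_continuous_on ballI
      has_vector_derivative_continuous[OF dilated_integral_has_vector_derivative])

lemma ball_integral_has_vector_derivative:
  assumes f: "test_function f" and t: "t > 0"
  shows "((\<lambda>t. LINT z:gball a t|lborel. f z) has_vector_derivative ball_integral_deriv f a t) (at t)"
proof (rule has_vector_derivative_transform_within_open[where S = "{0<..}"])
  have "((\<lambda>t::real. t ^ DIM('a)) has_real_derivative DIM('a) * t ^ (DIM('a) - 1)) (at t)"
    by (auto intro!: derivative_eq_intros)
  from has_vector_derivative_scaleR[OF this dilated_integral_has_vector_derivative[OF f]]
  show "((\<lambda>t. t ^ DIM('a) *\<^sub>R dilated_integral f a t) has_vector_derivative ball_integral_deriv f a t) (at t)"
    by (simp add: ball_integral_deriv_def add.commute)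
  show "s ^ DIM('a) *\<^sub>R dilated_integral f a s = (LINT z:gball a s|lborel. f z)" if "s \<in> {0<..}" for s
    using gball_integral_affine[of f s a] that borel_measurable_continuous_onI[OF test_function_continuous[OF f]]
    by (simp add: dilated_integral_def)
qed (use t in auto)

lemma phase_integrand_integrable:
  assumes f: "test_function f"
  shows "integrable lborel (\<lambda>z. f z * iexp (w * q (z - a)))"
proof (rule Bochner_Integration.integrable_bound[OF test_function_integrable[OF f]])
  have [measurable]: "f \<in> borel_measurable borel"
    using test_function_continuous[OF f] by (rule borel_measurable_continuous_onI)
  show "(\<lambda>z. f z * iexp (w * q (z - a))) \<in> borel_measurable lborel"
    by measurable
qed (simp add: norm_mult)

text \<open>A substitute for polar coordinates.  On the shell between the radii \<open>s\<close> and \<open>t\<close> the phase factor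
  differs from its value at radius \<open>t\<close> by \<open>O(\<bar>s - t\<bar>)\<close>, and the volume of the shell is also
  \<open>O(\<bar>s - t\<bar>)\<close>.  The error of freezing the phase is therefore of second order, and the derivative
  acquires exactly the factor \<open>exp (i w t\<^sup>2)\<close>.\<close>

lemma phase_integral_has_vector_derivative:
  assumes f: "test_function f" and t: "t > 0"
  shows "(phase_integral f a w has_vector_derivative ball_integral_deriv f a t * iexp (w * t\<^sup>2)) (at t)"
proof -
  obtain M where M: "M \<ge> 0" "\<And>x. norm (f x) \<le> M"
    using test_function_bounded[OF f] by blast
  define R where "R s = (LINT z:gball a s|lborel. f z)" for s
  define e where "e = iexp (w * t\<^sup>2)"
  define d where "d s = phase_integral f a w s - R s * e" for s
  define g where "g z = f z * iexp (w * q (z - a)) - f z * e" for z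
  have int1: "integrable lborel (\<lambda>z. f z * iexp (w * q (z - a)))"
    by (rule phase_integrand_integrable[OF f])
  have int2: "integrable lborel (\<lambda>z. f z * e)"
    using test_function_integrable[OF f] by simp
  have intg: "integrable lborel g"
    unfolding g_def by (rule Bochner_Integration.integrable_diff[OF int1 int2])
  have d_eq: "d s = (LINT z:gball a s|lborel. g z)" for s
  proof -
    have "set_integrable lborel (gball a s) (\<lambda>z. f z * iexp (w * q (z - a)))"
      unfolding set_integrable_def by (rule integrable_mult_indicator[OF _ int1]) simp
    moreover have "set_integrable lborel (gball a s) (\<lambda>z. f z * e)"
      unfolding set_integrable_def by (rule integrable_mult_indicator[OF _ int2]) simp
    ultimately have "(LINT z:gball a s|lborel. g z) =
       (LINT z:gball a s|lborel. f z * iexp (w * q (z - a))) - (LINT z:gball a s|lborel. f z * e)"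
      unfolding g_def by (rule set_integral_diff(2))
    then show ?thesis
      by (simp add: d_def R_def phase_integral_def)
  qed
  have est: "norm (d s - d t) \<le> M * (\<bar>w\<bar> * \<bar>s\<^sup>2 - t\<^sup>2\<bar>) * (vol * \<bar>s ^ DIM('a) - t ^ DIM('a)\<bar>)" if "s > 0" for s
    unfolding d_eq
  proof (rule gball_shell_bound_abs[OF intg])
    fix z assume z: "\<bar>q (z - a) - t\<^sup>2\<bar> \<le> \<bar>s\<^sup>2 - t\<^sup>2\<bar>"
    have "norm (g z) = norm (f z) * norm (iexp (w * q (z - a)) - e)"
      by (simp add: g_def norm_mult[symmetric] algebra_simps)
    also have "\<dots> \<le> M * (\<bar>w\<bar> * \<bar>s\<^sup>2 - t\<^sup>2\<bar>)"
    proof (intro mult_mono M)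
      have "norm (iexp (w * q (z - a)) - e) \<le> \<bar>w\<bar> * \<bar>q (z - a) - t\<^sup>2\<bar>"
        using norm_iexp_diff_le[of "w * q (z - a)" "w * t\<^sup>2"]
        by (simp add: e_def abs_mult[symmetric] algebra_simps)
      also have "\<dots> \<le> \<bar>w\<bar> * \<bar>s\<^sup>2 - t\<^sup>2\<bar>"
        by (intro mult_left_mono z) auto
      finally show "norm (iexp (w * q (z - a)) - e) \<le> \<bar>w\<bar> * \<bar>s\<^sup>2 - t\<^sup>2\<bar>" .
    qed auto
    finally show "norm (g z) \<le> M * (\<bar>w\<bar> * \<bar>s\<^sup>2 - t\<^sup>2\<bar>)" .
  qed (use that t in auto)
  \<comment> \<open>the quadratic bound \<open>est\<close>, divided by \<open>s - t\<close>, still tends to 0\<close>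
  have "(d has_vector_derivative 0) (at t)"
    unfolding has_vector_derivative_iff_slope
  proof (rule Lim_null_comparison)
    let ?\<omega> = "\<lambda>h. M * (\<bar>w\<bar> * \<bar>h + 2 * t\<bar>) * (vol * \<bar>(t + h) ^ DIM('a) - t ^ DIM('a)\<bar>)"
    have "\<forall>\<^sub>F h in at 0. h \<in> {-t<..<t}"
      using t by (intro eventually_at_in_open') auto
    moreover have "\<forall>\<^sub>F h in at 0. h \<noteq> (0::real)"
      by (rule eventually_neq_at_within)
    ultimately show "\<forall>\<^sub>F h in at 0. norm ((d (t + h) - d t) /\<^sub>R h) \<le> ?\<omega> h"
    proof eventually_elim
      case (elim h)
      have "(t + h)\<^sup>2 - t\<^sup>2 = h * (h + 2 * t)"
        by (simp add: power2_eq_square algebra_simps)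
      then have "norm (d (t + h) - d t) \<le> ?\<omega> h * \<bar>h\<bar>"
        using est[of "t + h"] elim by (simp add: abs_mult mult_ac)
      then have "norm (d (t + h) - d t) / \<bar>h\<bar> \<le> ?\<omega> h"
        using elim by (subst pos_divide_le_eq) auto
      moreover have "norm ((d (t + h) - d t) /\<^sub>R h) = norm (d (t + h) - d t) / \<bar>h\<bar>"
        by (simp add: divide_inverse mult.commute)
      ultimately show ?case
        by simp
    qed
    show "(?\<omega> \<longlongrightarrow> 0) (at 0)"
      by (auto intro!: tendsto_eq_intros)
  qed
  moreover have "((\<lambda>s. R s * e) has_vector_derivative ball_integral_deriv f a t * e) (at t)"
    unfolding R_def
    by (rule bounded_linear.has_vector_derivative[OF bounded_linear_mult_left ball_integral_has_vector_derivative[OF f t]])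
  ultimately have "((\<lambda>s. d s + R s * e) has_vector_derivative 0 + ball_integral_deriv f a t * e) (at t)"
    by (rule has_vector_derivative_add)
  then show ?thesis
    by (simp add: d_def e_def)
qed

lemma phase_integral_continuous:
  assumes f: "test_function f"
  shows "continuous_on {0..} (phase_integral f a w)"
  unfolding continuous_on_def
proof
  fix t :: real assume t: "t \<in> {0..}"
  obtain M where M: "M \<ge> 0" "\<And>x. norm (f x) \<le> M"
    using test_function_bounded[OF f] by blast
  have est: "norm (phase_integral f a w s - phase_integral f a w t) \<le> M * (vol * \<bar>s ^ DIM('a) - t ^ DIM('a)\<bar>)"
    if "s \<ge> 0" for s
    unfolding phase_integral_def
    by (rule gball_shell_bound_abs[OF phase_integrand_integrable[OF f]])
      (use that t M in \<open>auto simp: norm_mult\<close>)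
  have "((\<lambda>s. phase_integral f a w s - phase_integral f a w t) \<longlongrightarrow> 0) (at t within {0..})"
  proof (rule Lim_null_comparison)
    show "\<forall>\<^sub>F s in at t within {0..}. norm (phase_integral f a w s - phase_integral f a w t)
            \<le> M * (vol * \<bar>s ^ DIM('a) - t ^ DIM('a)\<bar>)"
      by (auto simp: eventually_at_filter est)
    show "((\<lambda>s. M * (vol * \<bar>s ^ DIM('a) - t ^ DIM('a)\<bar>)) \<longlongrightarrow> 0) (at t within {0..})"
      by (auto intro!: tendsto_eq_intros)
  qed
  then show "(phase_integral f a w \<longlongrightarrow> phase_integral f a w t) (at t within {0..})"
    by (rule LIM_zero_cancel)
qed

lemma phase_integral_0:
  assumes f: "test_function f"
  shows "phase_integral f a w 0 = 0"
proof -
  have "emeasure lborel (gball a 0) = 0"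
    using measure_gball[of 0 a] gball_emeasure_finite[of a 0]
    by (auto simp: measure_def enn2real_eq_0_iff zero_power)
  then have "AE z in lborel. z \<notin> gball a 0"
    by (intro AE_not_in) (auto simp: null_sets_def)
  then show ?thesis
    unfolding phase_integral_def set_lebesgue_integral_def
    by (intro integral_eq_zero_AE) (auto elim!: eventually_mono)
qed

text \<open>The integrand on the left is the derivative of the phase integral over the ball of radius \<open>t\<close>.
  That integral is continuous down to \<open>t = 0\<close>, where it vanishes, and it is the full integral as
  soon as the ball contains the support of \<open>f\<close>, so the fundamental theorem of calculus gives the
  right-hand side.\<close>

theorem integral_derivative_ball_integral:
  assumes f: "test_function f"
  shows "(LINT t:{0<..}|lborel. vector_derivative (\<lambda>t. LINT z:gball a t|lborel. f z) (at t) * iexp (w * t\<^sup>2)) =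
         (LINT z|lborel. f z * iexp (w * q (z - a)))"
proof -
  let ?D = "ball_integral_deriv f a" and ?W = "phase_integral f a w"
  obtain T where T: "T > 0" "\<And>z. f z \<noteq> 0 \<Longrightarrow> q (z - a) \<le> T\<^sup>2"
  proof -
    have "compact ((\<lambda>z. q (z - a)) ` closure {z. f z \<noteq> 0})"
      using f by (intro compact_continuous_image continuous_on_compose2[OF q_cont] continuous_intros)
        (auto simp: test_function_def)
    then obtain B where B: "\<forall>y\<in>(\<lambda>z. q (z - a)) ` closure {z. f z \<noteq> 0}. norm y \<le> B"
      using compact_imp_bounded bounded_iff by metis
    have "q (z - a) \<le> (\<bar>B\<bar> + 1)\<^sup>2" if "f z \<noteq> 0" for z
    proof -
      have "q (z - a) \<le> B"
        using B that subsetD[OF closure_subset, of z "{z. f z \<noteq> 0}"] by fastforce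
      also have "B \<le> (\<bar>B\<bar> + 1)\<^sup>2"
        using self_le_power[of "\<bar>B\<bar> + 1" 2] by linarith
      finally show ?thesis .
    qed
    then show ?thesis
      by (intro that[of "\<bar>B\<bar> + 1"]) auto
  qed
  have inside: "indicator (gball a t) z *\<^sub>R f z = f z" if "t \<ge> T" for t z
  proof (cases "f z = 0")
    case False
    then have "q (z - a) \<le> t\<^sup>2"
      using T(2)[of z] power_mono[OF that, of 2] T(1) by simp
    then show ?thesis by (simp add: gball_def)
  qed simp
  have D: "vector_derivative (\<lambda>t. LINT z:gball a t|lborel. f z) (at t) = ?D t" if "t > 0" for t
    by (rule vector_derivative_at[OF ball_integral_has_vector_derivative[OF f that]])
  have D0: "?D t = 0" if "t > T" for t
  proof -
    have "((\<lambda>t. LINT z:gball a t|lborel. f z) has_vector_derivative 0) (at t)"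
    proof (rule has_vector_derivative_transform_within_open[where S = "{T<..}" and f = "\<lambda>t. LINT z|lborel. f z"])
      show "(LINT z|lborel. f z) = (LINT z:gball a s|lborel. f z)" if "s \<in> {T<..}" for s
        using inside[of s] that by (simp add: set_lebesgue_integral_def)
    qed (use that in auto)
    then show ?thesis
      using ball_integral_has_vector_derivative[OF f, of t a] that T(1) vector_derivative_unique_at by fastforce
  qed
  have cont: "continuous_on {0..T} (\<lambda>t. ?D t * iexp (w * t\<^sup>2))"
    by (intro continuous_intros continuous_on_subset[OF ball_integral_deriv_continuous[OF f]]) auto
  have "(LINT t:{0<..}|lborel. vector_derivative (\<lambda>t. LINT z:gball a t|lborel. f z) (at t) * iexp (w * t\<^sup>2)) =
        (LINT t:{0..T}|lborel. ?D t * iexp (w * t\<^sup>2))"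
    unfolding set_lebesgue_integral_def
  proof (rule Bochner_Integration.integral_cong[OF refl, THEN trans])
    show "indicator {0<..} t *\<^sub>R (vector_derivative (\<lambda>t. LINT z|lborel. indicator (gball a t) z *\<^sub>R f z) (at t) * iexp (w * t\<^sup>2)) =
          indicator {0<..T} t *\<^sub>R (?D t * iexp (w * t\<^sup>2))" for t
      using D[of t] D0[of t] by (cases "t > 0"; cases "t \<le> T") (auto simp: set_lebesgue_integral_def indicator_def)
    have "(\<lambda>t. indicator {0..T} t *\<^sub>R (?D t * iexp (w * t\<^sup>2))) \<in> borel_measurable lborel"
      using borel_integrable_atLeastAtMost'[OF cont] by (auto simp: set_integrable_def)
    moreover have [measurable]: "?D \<in> borel_measurable borel"
      by (rule borel_measurable_continuous_onI[OF ball_integral_deriv_continuous[OF f]])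
    ultimately show "(LINT t|lborel. indicator {0<..T} t *\<^sub>R (?D t * iexp (w * t\<^sup>2))) =
          (LINT t|lborel. indicator {0..T} t *\<^sub>R (?D t * iexp (w * t\<^sup>2)))"
      by (intro integral_cong_AE) (use AE_lborel_singleton[of "0::real"] in \<open>auto simp: indicator_def elim!: eventually_mono\<close>)
  qed
  also have "\<dots> = integral {0..T} (\<lambda>t. ?D t * iexp (w * t\<^sup>2))"
    by (rule set_borel_integral_eq_integral(2)[OF borel_integrable_atLeastAtMost'[OF cont]])
  also have "\<dots> = ?W T - ?W 0"
    using T(1)
    by (intro integral_unique fundamental_theorem_of_calculus_interior phase_integral_has_vector_derivative[OF f]
        continuous_on_subset[OF phase_integral_continuous[OF f]]) auto
  also have "\<dots> = (LINT z|lborel. f z * iexp (w * q (z - a)))"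
  proof -
    have "indicator (gball a T) z *\<^sub>R (f z * iexp (w * q (z - a))) = f z * iexp (w * q (z - a))" for z
      using inside[of T z] by (metis mult_scaleR_left order_refl)
    then show ?thesis
      unfolding phase_integral_0[OF f] by (simp add: phase_integral_def set_lebesgue_integral_def)
  qed
  finally show ?thesis .
qed

end

section \<open>Fourier inversion\<close>

lemma
  fixes g :: "'a::euclidean_space \<Rightarrow> real \<Rightarrow> 'b::{real_normed_field, banach, second_countable_topology}"
  assumes g: "\<And>b. b \<in> Basis \<Longrightarrow> integrable lborel (g b)"
  shows integrable_lborel_prod: "integrable lborel (\<lambda>x. \<Prod>b\<in>Basis. g b (x \<bullet> b))"
    and integral_lborel_prod: "(\<integral>x. (\<Prod>b\<in>Basis. g b (x \<bullet> b)) \<partial>lborel) = (\<Prod>b\<in>Basis. \<integral>x. g b x \<partial>lborel)"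
proof -
  interpret product_sigma_finite "\<lambda>_::'a. lborel :: real measure"
    by standard
  have [measurable]: "b \<in> Basis \<Longrightarrow> g b \<in> borel_measurable borel" for b
    using g by auto
  have meas: "(\<lambda>x. \<Prod>b\<in>Basis. g b (x \<bullet> b)) \<in> borel_measurable borel"
    by measurable
  have meas': "(\<lambda>f. \<Sum>b\<in>Basis. f b *\<^sub>R b) \<in> (\<Pi>\<^sub>M b\<in>(Basis::'a set). (lborel::real measure)) \<rightarrow>\<^sub>M borel"
    by measurable
  have eq: "(\<Prod>b\<in>Basis. g b ((\<Sum>b'\<in>Basis. f b' *\<^sub>R b') \<bullet> b)) = (\<Prod>b\<in>Basis. g b (f b))" for f
    by (intro prod.cong refl) simp
  show "integrable lborel (\<lambda>x. \<Prod>b\<in>Basis. g b (x \<bullet> b))"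
    by (subst lborel_eq, subst integrable_distr_eq[OF meas' meas])
      (simp only: eq product_integrable_prod[OF finite_Basis g])
  show "(\<integral>x. (\<Prod>b\<in>Basis. g b (x \<bullet> b)) \<partial>lborel) = (\<Prod>b\<in>Basis. \<integral>x. g b x \<partial>lborel)"
    by (subst lborel_eq, subst integral_distr[OF meas' meas])
      (simp only: eq product_integral_prod[OF finite_Basis g])
qed

definition gauss :: "'a::euclidean_space \<Rightarrow> real" where
  "gauss x = exp (- (norm x)\<^sup>2 / 2)"

lemma gauss_prod: "gauss x = (\<Prod>b\<in>Basis. exp (- (x \<bullet> b)\<^sup>2 / 2))"
proof -
  have "(norm x)\<^sup>2 = (\<Sum>b\<in>Basis. (x \<bullet> b)\<^sup>2)"
    unfolding power2_norm_eq_inner by (subst euclidean_inner) (simp add: power2_eq_square)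
  then have "- (norm x)\<^sup>2 / 2 = (\<Sum>b\<in>Basis. - (x \<bullet> b)\<^sup>2 / 2)"
    by (simp add: sum_negf sum_divide_distrib)
  then show ?thesis
    by (simp add: gauss_def exp_sum)
qed

lemma gauss_measurable [measurable]: "gauss \<in> borel_measurable borel"
  unfolding gauss_def by measurable

lemma gauss_minus [simp]: "gauss (- x) = gauss x"
  by (simp add: gauss_def)

lemma
  shows gauss_char_integrable_1: "integrable lborel (\<lambda>x::real. iexp (y * x) * complex_of_real (exp (- x\<^sup>2 / 2)))"
    and gauss_char_1: "(\<integral>x. iexp (y * x) * complex_of_real (exp (- x\<^sup>2 / 2)) \<partial>lborel) =
          complex_of_real (sqrt (2 * pi) * exp (- y\<^sup>2 / 2))"
proof -
  have e: "exp (- x\<^sup>2 / 2) = sqrt (2 * pi) * std_normal_density x" for x :: real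
    by (simp add: std_normal_density_def)
  have "integrable lborel std_normal_density"
    by (rule integrable_normal_density) simp
  then have int: "integrable lborel (\<lambda>x. exp (- x\<^sup>2 / 2) :: real)"
    unfolding e by (rule integrable_mult_right)
  show "integrable lborel (\<lambda>x::real. iexp (y * x) * complex_of_real (exp (- x\<^sup>2 / 2)))"
    by (rule Bochner_Integration.integrable_bound[OF int]) (auto simp: norm_mult)
  have "complex_of_real (exp (- y\<^sup>2 / 2)) = char std_normal_distribution y"
    by (simp add: char_std_normal_distribution)
  also have "\<dots> = (\<integral>x. std_normal_density x *\<^sub>R iexp (y * x) \<partial>lborel)"
    unfolding char_def by (subst integral_density) (auto simp: normal_density_nonneg)
  finally have "complex_of_real (sqrt (2 * pi)) * complex_of_real (exp (- y\<^sup>2 / 2)) =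
      (\<integral>x. complex_of_real (sqrt (2 * pi)) * (std_normal_density x *\<^sub>R iexp (y * x)) \<partial>lborel)"
    by (simp only: integral_mult_right_zero)
  also have "\<dots> = (\<integral>x. iexp (y * x) * complex_of_real (exp (- x\<^sup>2 / 2)) \<partial>lborel)"
    unfolding e by (intro Bochner_Integration.integral_cong) (auto simp: scaleR_conv_of_real mult_ac)
  finally show "(\<integral>x. iexp (y * x) * complex_of_real (exp (- x\<^sup>2 / 2)) \<partial>lborel) =
          complex_of_real (sqrt (2 * pi) * exp (- y\<^sup>2 / 2))"
    by simp
qed

lemma iexp_gauss_prod:
  fixes x y :: "'a::euclidean_space"
  shows "iexp (y \<bullet> x) * complex_of_real (gauss x) =
        (\<Prod>b\<in>Basis. iexp ((y \<bullet> b) * (x \<bullet> b)) * complex_of_real (exp (- (x \<bullet> b)\<^sup>2 / 2)))"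
proof -
  have "\<i> * complex_of_real (y \<bullet> x) = (\<Sum>b\<in>Basis. \<i> * complex_of_real ((y \<bullet> b) * (x \<bullet> b)))"
    by (subst euclidean_inner) (simp add: sum_distrib_left)
  then have "iexp (y \<bullet> x) = (\<Prod>b\<in>Basis. iexp ((y \<bullet> b) * (x \<bullet> b)))"
    by (simp add: exp_sum)
  then show ?thesis
    by (simp add: gauss_prod prod.distrib)
qed

lemma
  fixes y :: "'a::euclidean_space"
  shows gauss_char_integrable: "integrable lborel (\<lambda>x. iexp (y \<bullet> x) * complex_of_real (gauss x))"
    and gauss_char: "(\<integral>x. iexp (y \<bullet> x) * complex_of_real (gauss x) \<partial>lborel) =
          complex_of_real (sqrt (2 * pi) ^ DIM('a) * gauss y)"
proof -
  show "integrable lborel (\<lambda>x. iexp (y \<bullet> x) * complex_of_real (gauss x))"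
    unfolding iexp_gauss_prod
    by (rule integrable_lborel_prod[of "\<lambda>b x. iexp ((y \<bullet> b) * x) * complex_of_real (exp (- x\<^sup>2 / 2))"])
      (rule gauss_char_integrable_1)
  have "(\<integral>x. iexp (y \<bullet> x) * complex_of_real (gauss x) \<partial>lborel) =
        (\<Prod>b\<in>Basis. \<integral>x. iexp ((y \<bullet> b) * x) * complex_of_real (exp (- x\<^sup>2 / 2)) \<partial>lborel)"
    unfolding iexp_gauss_prod
    by (rule integral_lborel_prod[of "\<lambda>b x. iexp ((y \<bullet> b) * x) * complex_of_real (exp (- x\<^sup>2 / 2))"])
      (rule gauss_char_integrable_1)
  also have "\<dots> = (\<Prod>b\<in>(Basis::'a set). complex_of_real (sqrt (2 * pi) * exp (- (y \<bullet> b)\<^sup>2 / 2)))"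
    by (simp only: gauss_char_1)
  also have "\<dots> = complex_of_real (sqrt (2 * pi) ^ DIM('a) * gauss y)"
    by (simp add: gauss_prod prod.distrib)
  finally show "(\<integral>x. iexp (y \<bullet> x) * complex_of_real (gauss x) \<partial>lborel) =
          complex_of_real (sqrt (2 * pi) ^ DIM('a) * gauss y)" .
qed

lemma gauss_integrable: "integrable lborel (gauss :: 'a::euclidean_space \<Rightarrow> real)"
proof -
  have "integrable lborel (\<lambda>x::'a. norm (iexp (0 \<bullet> x) * complex_of_real (gauss x)))"
    by (rule integrable_norm[OF gauss_char_integrable])
  then show ?thesis
    by (simp add: gauss_def[abs_def])
qed

lemma gauss_scaled_char:
  fixes v :: "'a::euclidean_space"
  assumes e: "e > 0"
  shows "(\<integral>\<beta>. iexp (\<beta> \<bullet> v) * complex_of_real (gauss (e *\<^sub>R \<beta>)) \<partial>lborel) =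
          complex_of_real ((sqrt (2 * pi) / e) ^ DIM('a) * gauss (v /\<^sub>R e))"
proof -
  have "(\<integral>\<beta>. iexp (\<beta> \<bullet> v) * complex_of_real (gauss (e *\<^sub>R \<beta>)) \<partial>lborel) =
      \<bar>1 / e\<bar> ^ DIM('a) *\<^sub>R (\<integral>x. iexp ((0 + (1 / e) *\<^sub>R x) \<bullet> v) * complex_of_real (gauss (e *\<^sub>R (0 + (1 / e) *\<^sub>R x))) \<partial>lborel)"
    by (rule lborel_integral_affine) (use e in \<open>measurable, auto\<close>)
  also have "(\<lambda>x::'a. iexp ((0 + (1 / e) *\<^sub>R x) \<bullet> v) * complex_of_real (gauss (e *\<^sub>R (0 + (1 / e) *\<^sub>R x)))) =
     (\<lambda>x. iexp ((v /\<^sub>R e) \<bullet> x) * complex_of_real (gauss x))"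
    using e by (simp add: fun_eq_iff inner_commute divide_inverse)
  also have "(\<integral>x. \<dots> x \<partial>lborel) = complex_of_real (sqrt (2 * pi) ^ DIM('a) * gauss (v /\<^sub>R e))"
    by (rule gauss_char)
  finally show ?thesis
    using e by (simp add: scaleR_conv_of_real power_divide)
qed

definition fourier :: "('a::euclidean_space \<Rightarrow> complex) \<Rightarrow> 'a \<Rightarrow> complex" where
  "fourier h \<beta> = (\<integral>y. h y * iexp (- (\<beta> \<bullet> y)) \<partial>lborel)"

text \<open>The Gaussian factor makes the double integral absolutely convergent.  Fubini then transfers the
  transform from \<open>h\<close> to the Gaussian, whose transform is a Gaussian of width \<open>e\<close> centred at \<open>x\<close>.\<close>

lemma gauss_regularised_inversion:
  fixes h :: "'a::euclidean_space \<Rightarrow> complex"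
  assumes h: "integrable lborel h" and e: "e > 0"
  shows "(\<integral>\<beta>. fourier h \<beta> * iexp (\<beta> \<bullet> x) * complex_of_real (gauss (e *\<^sub>R \<beta>)) \<partial>lborel) =
         complex_of_real (sqrt (2 * pi) ^ DIM('a)) * (\<integral>z. h (x + e *\<^sub>R z) * complex_of_real (gauss z) \<partial>lborel)"
proof -
  have [measurable]: "h \<in> borel_measurable borel"
    using h by auto
  let ?F = "\<lambda>(\<beta>, y). h y * iexp (\<beta> \<bullet> (x - y)) * complex_of_real (gauss (e *\<^sub>R \<beta>))"
  have intg: "integrable lborel (\<lambda>\<beta>::'a. gauss (e *\<^sub>R \<beta>))"
    by (rule lborel_integrable_affine[of _ "1 / e" 0]) (use e gauss_integrable in auto)
  have int: "integrable (lborel \<Otimes>\<^sub>M lborel) ?F"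
  proof (rule lborel_pair.Fubini_integrable)
    show "integrable lborel (\<lambda>\<beta>. \<integral>y. norm (?F (\<beta>, y)) \<partial>lborel)"
      using intg by (simp add: norm_mult gauss_def)
    show "AE \<beta> in lborel. integrable lborel (\<lambda>y. ?F (\<beta>, y))"
    proof (rule AE_I2)
      fix \<beta> :: 'a
      show "integrable lborel (\<lambda>y. ?F (\<beta>, y))"
        by (rule Bochner_Integration.integrable_bound[OF integrable_norm[OF h]])
          (auto simp: norm_mult gauss_def mult_left_le)
    qed
  qed measurable
  have "(\<integral>\<beta>. fourier h \<beta> * iexp (\<beta> \<bullet> x) * complex_of_real (gauss (e *\<^sub>R \<beta>)) \<partial>lborel) =
        (\<integral>\<beta>. (\<integral>y. ?F (\<beta>, y) \<partial>lborel) \<partial>lborel)"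
  proof (rule Bochner_Integration.integral_cong[OF refl])
    fix \<beta> :: 'a
    have "fourier h \<beta> * (iexp (\<beta> \<bullet> x) * complex_of_real (gauss (e *\<^sub>R \<beta>))) =
        (\<integral>y. h y * iexp (- (\<beta> \<bullet> y)) * (iexp (\<beta> \<bullet> x) * complex_of_real (gauss (e *\<^sub>R \<beta>))) \<partial>lborel)"
      unfolding fourier_def by (rule integral_mult_left_zero[symmetric])
    also have "\<dots> = (\<integral>y. ?F (\<beta>, y) \<partial>lborel)"
      by (intro Bochner_Integration.integral_cong refl)
        (simp add: inner_diff_right algebra_simps exp_diff exp_minus divide_inverse)
    finally show "fourier h \<beta> * iexp (\<beta> \<bullet> x) * complex_of_real (gauss (e *\<^sub>R \<beta>)) = (\<integral>y. ?F (\<beta>, y) \<partial>lborel)"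
      by (simp add: mult.assoc)
  qed
  also have "\<dots> = (\<integral>y. (\<integral>\<beta>. ?F (\<beta>, y) \<partial>lborel) \<partial>lborel)"
    using lborel_pair.Fubini_integral[of "\<lambda>\<beta> y. ?F (\<beta>, y)"] int by simp
  also have "\<dots> = (\<integral>y. h y * complex_of_real ((sqrt (2 * pi) / e) ^ DIM('a) * gauss ((x - y) /\<^sub>R e)) \<partial>lborel)"
    by (intro Bochner_Integration.integral_cong refl)
      (simp only: prod.case mult.assoc integral_mult_right_zero gauss_scaled_char[OF e])
  also have "\<dots> = \<bar>e\<bar> ^ DIM('a) *\<^sub>R (\<integral>z. h (x + e *\<^sub>R z) *
         complex_of_real ((sqrt (2 * pi) / e) ^ DIM('a) * gauss ((x - (x + e *\<^sub>R z)) /\<^sub>R e)) \<partial>lborel)"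
    by (rule lborel_integral_affine) (use e in \<open>measurable, auto\<close>)
  also have "(\<lambda>z. h (x + e *\<^sub>R z) *
         complex_of_real ((sqrt (2 * pi) / e) ^ DIM('a) * gauss ((x - (x + e *\<^sub>R z)) /\<^sub>R e))) =
       (\<lambda>z. complex_of_real ((sqrt (2 * pi) / e) ^ DIM('a)) * (h (x + e *\<^sub>R z) * complex_of_real (gauss z)))"
    using e by (auto simp: fun_eq_iff)
  also have "\<bar>e\<bar> ^ DIM('a) *\<^sub>R (\<integral>z. \<dots> z \<partial>lborel) =
      complex_of_real (sqrt (2 * pi) ^ DIM('a)) * (\<integral>z. h (x + e *\<^sub>R z) * complex_of_real (gauss z) \<partial>lborel)"
    using e by (simp add: scaleR_conv_of_real power_divide)
  finally show ?thesis .
qed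

text \<open>As \<open>e\<close> tends to 0, integrability of the transform controls the left-hand side of the regularised
  identity, and boundedness with continuity of \<open>h\<close> controls the right-hand side.  The power of
  \<open>2 * pi\<close> is made of two factors \<open>sqrt (2 * pi) ^ DIM('a)\<close>: one from transforming the
  Gaussian and one from its total mass.\<close>

theorem fourier_inversion:
  fixes h :: "'a::euclidean_space \<Rightarrow> complex"
  assumes h: "integrable lborel h" and cont: "continuous_on UNIV h" and bound: "\<And>x. norm (h x) \<le> M"
    and fh: "integrable lborel (fourier h)"
  shows "(\<integral>\<beta>. fourier h \<beta> * iexp (\<beta> \<bullet> x) \<partial>lborel) = complex_of_real ((2 * pi) ^ DIM('a)) * h x"
proof -
  have [measurable]: "h \<in> borel_measurable borel" "fourier h \<in> borel_measurable borel"
    using h fh by auto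
  define e where "e n = 1 / real (Suc n)" for n
  have e: "e n > 0" for n
    by (simp add: e_def)
  have e0: "e \<longlonglongrightarrow> 0"
    unfolding e_def using LIMSEQ_inverse_real_of_nat by (simp add: divide_inverse)
  have g1: "(\<lambda>n. gauss (e n *\<^sub>R \<beta>)) \<longlonglongrightarrow> 1" for \<beta> :: 'a
    unfolding gauss_def by (auto intro!: tendsto_eq_intros e0)
  have gle: "gauss \<beta> \<le> 1" "gauss \<beta> \<ge> 0" for \<beta> :: 'a
    by (auto simp: gauss_def)
  have L: "(\<lambda>n. \<integral>\<beta>. fourier h \<beta> * iexp (\<beta> \<bullet> x) * complex_of_real (gauss (e n *\<^sub>R \<beta>)) \<partial>lborel)
        \<longlonglongrightarrow> (\<integral>\<beta>. fourier h \<beta> * iexp (\<beta> \<bullet> x) \<partial>lborel)"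
  proof (rule integral_dominated_convergence[where w = "\<lambda>\<beta>. norm (fourier h \<beta>)"])
    have "(\<lambda>n. fourier h \<beta> * iexp (\<beta> \<bullet> x) * complex_of_real (gauss (e n *\<^sub>R \<beta>)))
            \<longlonglongrightarrow> fourier h \<beta> * iexp (\<beta> \<bullet> x) * complex_of_real 1" for \<beta>
      by (intro tendsto_mult tendsto_const tendsto_of_real g1)
    then show "AE \<beta> in lborel. (\<lambda>n. fourier h \<beta> * iexp (\<beta> \<bullet> x) * complex_of_real (gauss (e n *\<^sub>R \<beta>)))
            \<longlonglongrightarrow> fourier h \<beta> * iexp (\<beta> \<bullet> x)"
      by simp
    show "AE \<beta> in lborel. norm (fourier h \<beta> * iexp (\<beta> \<bullet> x) * complex_of_real (gauss (e n *\<^sub>R \<beta>)))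
            \<le> norm (fourier h \<beta>)" for n
      using gle by (auto simp: norm_mult intro!: AE_I2 mult_left_le)
  qed (use fh in \<open>auto intro: integrable_norm\<close>)
  have R: "(\<lambda>n. \<integral>z. h (x + e n *\<^sub>R z) * complex_of_real (gauss z) \<partial>lborel)
        \<longlonglongrightarrow> (\<integral>z. h x * complex_of_real (gauss (z::'a)) \<partial>lborel)"
  proof (rule integral_dominated_convergence[where w = "\<lambda>z. M * gauss z"])
    show "AE z in lborel. (\<lambda>n. h (x + e n *\<^sub>R z) * complex_of_real (gauss z))
            \<longlonglongrightarrow> h x * complex_of_real (gauss z)"
    proof (intro AE_I2 tendsto_intros)
      fix z
      have "(\<lambda>n. x + e n *\<^sub>R z) \<longlonglongrightarrow> x"
        by (auto intro!: tendsto_eq_intros e0)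
      then show "(\<lambda>n. h (x + e n *\<^sub>R z)) \<longlonglongrightarrow> h x"
        by (rule continuous_on_tendsto_compose[OF cont]) auto
    qed
    show "AE z in lborel. norm (h (x + e n *\<^sub>R z) * complex_of_real (gauss z)) \<le> M * gauss z" for n
    proof (rule AE_I2)
      show "norm (h (x + e n *\<^sub>R z) * complex_of_real (gauss z)) \<le> M * gauss z" for z
        using mult_right_mono[OF bound gle(2)] gle(2)[of z] by (simp add: norm_mult)
    qed
  qed (use gauss_integrable in auto)
  have G: "(\<integral>z. h x * complex_of_real (gauss (z::'a)) \<partial>lborel) = h x * complex_of_real (sqrt (2 * pi) ^ DIM('a))"
    using gauss_char[of "0::'a"] by (simp add: gauss_def)
  have "(\<lambda>n. \<integral>\<beta>. fourier h \<beta> * iexp (\<beta> \<bullet> x) * complex_of_real (gauss (e n *\<^sub>R \<beta>)) \<partial>lborel)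
        \<longlonglongrightarrow> complex_of_real (sqrt (2 * pi) ^ DIM('a)) * (h x * complex_of_real (sqrt (2 * pi) ^ DIM('a)))"
    unfolding gauss_regularised_inversion[OF h e] by (rule tendsto_mult_left[OF R[unfolded G]])
  from LIMSEQ_unique[OF L this]
  have "(\<integral>\<beta>. fourier h \<beta> * iexp (\<beta> \<bullet> x) \<partial>lborel) =
      complex_of_real (sqrt (2 * pi) ^ DIM('a) * sqrt (2 * pi) ^ DIM('a)) * h x"
    by simp
  also have "sqrt (2 * pi) ^ DIM('a) * sqrt (2 * pi) ^ DIM('a) = (2 * pi) ^ DIM('a)"
    by (subst power_mult_distrib[symmetric]) simp
  finally show ?thesis .
qed

section \<open>Partial Fourier transforms of test functions\<close>

text \<open>By translation invariance the integral of \<open>f (z + s *\<^sub>R v)\<close> does not depend on \<open>s\<close>;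
  its derivative at \<open>s = 0\<close> is the integral in question.\<close>

lemma integral_directional_derivative_eq_0:
  fixes f :: "'a::euclidean_space \<Rightarrow> complex"
  assumes f: "test_function f"
  shows "(\<integral>z. frechet_derivative f (at z) v \<partial>lborel) = 0"
proof -
  obtain M where M: "M \<ge> 0" "\<And>x. norm (frechet_derivative f (at x) v) \<le> M"
    using test_function_bounded[OF test_function_frechet[OF f]] by blast
  obtain r where r: "r > 0" "\<And>x. frechet_derivative f (at x) v \<noteq> 0 \<Longrightarrow> norm x \<le> r"
    using test_function_bounded_support[OF test_function_frechet[OF f]] by blast
  have [measurable]: "f \<in> borel_measurable borel"
    using test_function_continuous[OF f] by (rule borel_measurable_continuous_onI)
  let ?\<rho> = "r + norm v"
  have shift: "(\<integral>z. f (z + s *\<^sub>R v) \<partial>lborel) = (\<integral>z. f z \<partial>lborel)" for s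
    using lborel_integral_affine[of f 1 "s *\<^sub>R v"] by (simp add: add.commute)
  have "((\<lambda>s. \<integral>z. f (z + s *\<^sub>R v) \<partial>lborel) has_vector_derivative
        (\<integral>z. frechet_derivative f (at (z + 0 *\<^sub>R v)) v \<partial>lborel)) (at 0)"
  proof (rule has_vector_derivative_integral[where r = 1 and g = "\<lambda>z. indicator (cball 0 ?\<rho>) z * M"])
    show "integrable lborel (\<lambda>z. f (z + s *\<^sub>R v))" for s
      by (rule lborel_integrable_affine[of _ 1 "- (s *\<^sub>R v)"]) (use test_function_integrable[OF f] in auto)
    show "norm (frechet_derivative f (at (z + s *\<^sub>R v)) v) \<le> indicator (cball 0 ?\<rho>) z * M"
      if "\<bar>s - 0\<bar> < 1" for s z
    proof (cases "frechet_derivative f (at (z + s *\<^sub>R v)) v = 0")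
      case False
      then have "norm (z + s *\<^sub>R v) \<le> r"
        by (rule r(2))
      moreover have "norm (s *\<^sub>R v) \<le> norm v"
        using that by (simp add: mult_left_le_one_le)
      ultimately have "norm z \<le> ?\<rho>"
        using norm_triangle_ineq4[of "z + s *\<^sub>R v" "s *\<^sub>R v"] by simp
      then show ?thesis
        using M by simp
    qed (use M in simp)
    show "integrable lborel (\<lambda>z. indicator (cball 0 ?\<rho>) z * M)"
      by (intro integrable_mult_left integrable_real_indicator emeasure_bounded_finite) auto
  qed (simp, rule test_function_line_derivative[OF f])
  then have "((\<lambda>s. \<integral>z. f z \<partial>lborel) has_vector_derivative
        (\<integral>z. frechet_derivative f (at z) v \<partial>lborel)) (at 0)"
    by (simp add: shift)
  then show ?thesis
    using vector_derivative_unique_at[OF _ has_vector_derivative_const] by blast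
qed

text \<open>The transform in the first variable of the function obtained by integrating out the second one,
  written as a single integral so that integration by parts can be done in the product space.\<close>

definition partial_fourier :: "('a::euclidean_space \<times> 'b::euclidean_space \<Rightarrow> complex) \<Rightarrow> 'a \<Rightarrow> complex" where
  "partial_fourier f \<beta> = (\<integral>z. f z * iexp (- (\<beta> \<bullet> fst z)) \<partial>lborel)"

lemma partial_fourier_integrand_integrable:
  fixes f :: "'a::euclidean_space \<times> 'b::euclidean_space \<Rightarrow> complex"
  assumes f: "test_function f"
  shows "integrable lborel (\<lambda>z. f z * iexp (- (\<beta> \<bullet> fst z)))"
proof (rule Bochner_Integration.integrable_bound[OF test_function_integrable[OF f]])
  have [measurable]: "f \<in> borel_measurable borel"
    using test_function_continuous[OF f] by (rule borel_measurable_continuous_onI)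
  have [measurable]: "(\<lambda>z::'a \<times> 'b. iexp (- (\<beta> \<bullet> fst z))) \<in> borel_measurable borel"
    by (intro borel_measurable_continuous_onI continuous_intros)
  show "(\<lambda>z. f z * iexp (- (\<beta> \<bullet> fst z))) \<in> borel_measurable lborel"
    by measurable
qed (simp add: norm_mult)

text \<open>Integration by parts: the directional derivative of the product of \<open>f\<close> and the exponential
  integrates to 0.\<close>

lemma partial_fourier_derivative:
  fixes f :: "'a::euclidean_space \<times> 'b::euclidean_space \<Rightarrow> complex"
  assumes f: "test_function f"
  shows "partial_fourier (\<lambda>z. frechet_derivative f (at z) v) \<beta> =
         \<i> * complex_of_real (\<beta> \<bullet> fst v) * partial_fourier f \<beta>"
proof -
  define e where "e z = iexp (1 * (- (\<beta> \<bullet> fst z)))" for z :: "'a \<times> 'b"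
  have lin: "bounded_linear (\<lambda>v::'a \<times> 'b. - (\<beta> \<bullet> fst v))"
    by (intro bounded_linear_minus bounded_linear_compose[OF bounded_linear_inner_right] bounded_linear_fst)
  have phase: "((\<lambda>z::'a \<times> 'b. - (\<beta> \<bullet> fst z)) has_derivative (\<lambda>v. - (\<beta> \<bullet> fst v))) (at z)" for z
    using lin by (rule bounded_linear_imp_has_derivative)
  have eder: "(e has_derivative (\<lambda>v. e z * (\<i> * complex_of_real (- (\<beta> \<bullet> fst v))))) (at z)" for z
  proof -
    have "((\<lambda>z::'a \<times> 'b. \<i> * complex_of_real (1 * (- (\<beta> \<bullet> fst z)))) has_derivative
           (\<lambda>v. \<i> * complex_of_real (1 * (- (\<beta> \<bullet> fst v))))) (at z)"
      by (intro has_derivative_mult_right has_derivative_of_real phase)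
    from has_derivative_compose[OF this DERIV_exp[unfolded has_field_derivative_def]]
    show ?thesis
      unfolding e_def by simp
  qed
  have eC: "C_diff m e" for m
    unfolding e_def[abs_def] using phase by (rule C_diff_iexp) (rule C_diff_const)
  have fe: "test_function (\<lambda>z. f z * e z)"
    by (rule test_function_mult[OF f eC])
  have "frechet_derivative (\<lambda>z. f z * e z) (at z) v =
        frechet_derivative f (at z) v * e z - \<i> * complex_of_real (\<beta> \<bullet> fst v) * (f z * e z)" for z
    unfolding frechet_derivative_at[OF has_derivative_mult[OF test_function_has_derivative[OF f] eder], symmetric]
    by (simp add: algebra_simps)
  then have "0 = (\<integral>z. frechet_derivative f (at z) v * e z - \<i> * complex_of_real (\<beta> \<bullet> fst v) * (f z * e z) \<partial>lborel)"
    using integral_directional_derivative_eq_0[OF fe, of v] by simp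
  also have "\<dots> = (\<integral>z. frechet_derivative f (at z) v * e z \<partial>lborel)
        - (\<integral>z. \<i> * complex_of_real (\<beta> \<bullet> fst v) * (f z * e z) \<partial>lborel)"
    by (intro Bochner_Integration.integral_diff integrable_mult_right test_function_integrable
        test_function_mult[OF test_function_frechet[OF f] eC] fe)
  finally show ?thesis
    by (simp add: partial_fourier_def e_def)
qed


text \<open>Two derivatives in a direction multiply the transform by \<open>- (\<beta> \<bullet> b)\<^sup>2\<close>, so the
  factor \<open>1 + (\<beta> \<bullet> b)\<^sup>2\<close> can be absorbed into the test function, for all basis directions in
  turn.\<close>

lemma partial_fourier_absorb_factors:
  fixes f :: "'a::euclidean_space \<times> 'b::euclidean_space \<Rightarrow> complex"
  assumes f: "test_function f" and "finite J"
  shows "\<exists>g :: 'a \<times> 'b \<Rightarrow> complex. test_function g \<and>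
    (\<forall>\<beta>. (\<Prod>b\<in>J. complex_of_real (1 + (\<beta> \<bullet> b)\<^sup>2)) * partial_fourier f \<beta> = partial_fourier g \<beta>)"
  using \<open>finite J\<close>
proof (induction J)
  case empty
  then show ?case using f by (auto intro!: exI[of _ f])
next
  case (insert b J)
  then obtain g :: "'a \<times> 'b \<Rightarrow> complex" where g: "test_function g"
    "\<And>\<beta>. (\<Prod>b\<in>J. complex_of_real (1 + (\<beta> \<bullet> b)\<^sup>2)) * partial_fourier f \<beta> = partial_fourier g \<beta>"
    by blast
  define g1 where "g1 = (\<lambda>z. frechet_derivative g (at z) (b, 0))"
  define g2 where "g2 = (\<lambda>z. frechet_derivative g1 (at z) (b, 0))"
  have t1: "test_function g1" and t2: "test_function g2"
    using test_function_frechet g(1) by (auto simp: g1_def g2_def)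
  have "partial_fourier (\<lambda>z. g z - g2 z) \<beta> = complex_of_real (1 + (\<beta> \<bullet> b)\<^sup>2) * partial_fourier g \<beta>" for \<beta>
  proof -
    have "partial_fourier (\<lambda>z. g z - g2 z) \<beta> = partial_fourier g \<beta> - partial_fourier g2 \<beta>"
      unfolding partial_fourier_def left_diff_distrib
      by (rule Bochner_Integration.integral_diff[OF g(1)[THEN partial_fourier_integrand_integrable] t2[THEN partial_fourier_integrand_integrable]])
    moreover have "partial_fourier g2 \<beta> = - complex_of_real ((\<beta> \<bullet> b)\<^sup>2) * partial_fourier g \<beta>"
      using partial_fourier_derivative[OF t1, of "(b, 0)" \<beta>] partial_fourier_derivative[OF g(1), of "(b, 0)" \<beta>]
      by (simp add: g1_def g2_def power2_eq_square algebra_simps)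
    ultimately show ?thesis
      by (simp add: algebra_simps)
  qed
  then show ?case
    using insert.hyps g(2) test_function_diff[OF g(1) t2]
    by (intro exI[of _ "\<lambda>z. g z - g2 z"]) (auto simp: mult.assoc)
qed

text \<open>With all factors absorbed, the transform is bounded by a constant times the product of the
  functions \<open>1 / (1 + (\<beta> \<bullet> b)\<^sup>2)\<close>, and the integral of that product factorises.\<close>

lemma partial_fourier_integrable:
  fixes f :: "'a::euclidean_space \<times> 'b::euclidean_space \<Rightarrow> complex"
  assumes f: "test_function f"
  shows "integrable lborel (partial_fourier f)"
proof -
  obtain g :: "'a \<times> 'b \<Rightarrow> complex" where g: "test_function g"
    "\<And>\<beta>. (\<Prod>b\<in>Basis. complex_of_real (1 + (\<beta> \<bullet> b)\<^sup>2)) * partial_fourier f \<beta> = partial_fourier g \<beta>"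
    using partial_fourier_absorb_factors[OF f finite_Basis] by blast
  define B where "B = (\<integral>z. norm (g z) \<partial>lborel)"
  have B: "norm (partial_fourier g \<beta>) \<le> B" for \<beta>
    unfolding partial_fourier_def B_def
    using integral_norm_bound[of lborel "\<lambda>z. g z * iexp (- (\<beta> \<bullet> fst z))"] by (simp add: norm_mult)
  have "integrable lborel (\<lambda>x::real. inverse (1 + x\<^sup>2))"
    using integrable_inverse_1_plus_square by (simp add: set_integrable_def)
  then have int: "integrable lborel (\<lambda>\<beta>::'a. B * (\<Prod>b\<in>Basis. inverse (1 + (\<beta> \<bullet> b)\<^sup>2)))"
    using integrable_lborel_prod[of "\<lambda>_::'a. \<lambda>x::real. inverse (1 + x\<^sup>2)"] by auto
  have meas: "partial_fourier f \<in> borel_measurable borel"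
  proof (rule borel_measurable_continuous_onI)
    show "continuous_on UNIV (partial_fourier f)"
      unfolding partial_fourier_def[abs_def]
    proof (rule continuous_on_integral[where g = "\<lambda>z. norm (f z)"])
      show "(\<lambda>z. f z * iexp (- (\<beta> \<bullet> fst z))) \<in> borel_measurable lborel" for \<beta>
        using partial_fourier_integrand_integrable[OF f] by (rule borel_measurable_integrable)
      show "continuous_on UNIV (\<lambda>\<beta>. f z * iexp (- (\<beta> \<bullet> fst z)))" for z
        by (intro continuous_intros)
    qed (use test_function_integrable[OF f] in \<open>auto simp: norm_mult\<close>)
  qed
  show ?thesis
  proof (rule Bochner_Integration.integrable_bound[OF int])
    show "AE \<beta> in lborel. norm (partial_fourier f \<beta>) \<le> norm (B * (\<Prod>b\<in>Basis. inverse (1 + (\<beta> \<bullet> b)\<^sup>2)))"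
    proof (rule AE_I2)
      fix \<beta> :: 'a
      let ?P = "\<Prod>b\<in>(Basis::'a set). 1 + (\<beta> \<bullet> b)\<^sup>2"
      have P: "?P > 0"
        by (rule prod_pos) (auto simp: add_pos_nonneg)
      have "partial_fourier g \<beta> = complex_of_real ?P * partial_fourier f \<beta>"
        unfolding of_real_prod by (rule g(2)[symmetric])
      then have "norm (partial_fourier g \<beta>) = ?P * norm (partial_fourier f \<beta>)"
        using P by (simp only: norm_mult norm_of_real abs_of_pos)
      then have "norm (partial_fourier f \<beta>) \<le> B * inverse ?P"
        using B[of \<beta>] P by (simp add: field_simps)
      also have "\<dots> \<le> norm (B * (\<Prod>b\<in>Basis. inverse (1 + (\<beta> \<bullet> b)\<^sup>2)))"
        using prod_inversef[of "\<lambda>b. 1 + (\<beta> \<bullet> b)\<^sup>2" Basis] by (simp add: o_def)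
      finally show "norm (partial_fourier f \<beta>) \<le> norm (B * (\<Prod>b\<in>Basis. inverse (1 + (\<beta> \<bullet> b)\<^sup>2)))" .
    qed
  qed (use meas in simp)
qed

text \<open>By Fubini the partial transform of \<open>f\<close> is the Fourier transform of its marginal in the first
  variable, to which the inversion theorem applies.\<close>

theorem partial_fourier_inversion:
  fixes f :: "'a::euclidean_space \<times> 'b::euclidean_space \<Rightarrow> complex"
  assumes f: "test_function f"
  shows "(\<integral>\<beta>. partial_fourier f \<beta> * iexp (\<beta> \<bullet> x) \<partial>lborel) =
         complex_of_real ((2 * pi) ^ DIM('a)) * (\<integral>s. f (x, s) \<partial>lborel)"
proof -
  define h where "h y = (\<integral>s. f (y, s) \<partial>lborel)" for y
  obtain M where M: "M \<ge> 0" "\<And>x. norm (f x) \<le> M"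
    using test_function_bounded[OF f] by blast
  obtain r where r: "r > 0" "\<And>x. f x \<noteq> 0 \<Longrightarrow> norm x \<le> r"
    using test_function_bounded_support[OF f] by blast
  have fle: "norm (f (y, s)) \<le> indicator (cball 0 r) s * M" for y s
  proof (cases "f (y, s) = 0")
    case False
    then have "norm s \<le> r"
      using r(2)[of "(y, s)"] norm_snd_le[of s y] by (meson order_trans)
    then show ?thesis
      using M by simp
  qed (use M in simp)
  have int: "integrable lborel (\<lambda>s::'b. indicator (cball 0 r) s * M)"
    by (intro integrable_mult_left integrable_real_indicator emeasure_bounded_finite) auto
  have cont: "continuous_on UNIV (\<lambda>s. f (y, s))" "continuous_on UNIV (\<lambda>y. f (y, s))" for y s
    by (rule continuous_on_compose2[OF test_function_continuous[OF f]], auto intro!: continuous_intros)+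
  have hcont: "continuous_on UNIV h"
    unfolding h_def
    by (rule continuous_on_integral[OF _ _ fle int]) (auto intro: borel_measurable_continuous_onI cont)
  have hle: "norm (h y) \<le> (\<integral>s. indicator (cball (0::'b) r) s * M \<partial>lborel)" for y
    unfolding h_def
  proof (rule Bochner_Integration.integral_norm_bound_integral[OF _ int])
    show "integrable lborel (\<lambda>s. f (y, s))"
      by (rule Bochner_Integration.integrable_bound[OF int])
        (use fle[of y] M in \<open>auto intro: borel_measurable_continuous_onI cont\<close>)
  qed (rule fle)
  have prod: "integrable (lborel \<Otimes>\<^sub>M lborel) (\<lambda>(y, s). f (y, s))"
    using test_function_integrable[OF f] by (simp add: lborel_prod)
  have hint: "integrable lborel h"
    unfolding h_def using lborel_pair.integrable_fst[OF prod] .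
  have "fourier h \<beta> = partial_fourier f \<beta>" for \<beta>
  proof -
    have "integrable (lborel \<Otimes>\<^sub>M lborel) (\<lambda>(y, s). f (y, s) * iexp (- (\<beta> \<bullet> y)))"
      using partial_fourier_integrand_integrable[OF f, of \<beta>] by (simp add: lborel_prod case_prod_beta')
    from lborel_pair.integral_fst[OF this] show ?thesis
      by (simp add: fourier_def h_def partial_fourier_def lborel_prod case_prod_beta')
  qed
  then have eq: "fourier h = partial_fourier f"
    by blast
  show ?thesis
    using fourier_inversion[OF hint hcont hle] partial_fourier_integrable[OF f]
    unfolding eq by (simp add: h_def)
qed

section \<open>Inversion in the variable dual to the squared radius\<close>

text \<open>The gauge integral over the line is the limit over compact intervals whose two ends tend to
  infinity independently.  A primitive with limits at both ends is therefore enough, and the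
  integrand need not be absolutely integrable.\<close>

lemma has_integral_UNIV_of_primitive:
  fixes V h :: "real \<Rightarrow> 'b::banach"
  assumes der: "\<And>x. (V has_vector_derivative h x) (at x)"
    and top: "(V \<longlongrightarrow> L1) at_top" and bot: "(V \<longlongrightarrow> L2) at_bot"
  shows "(h has_integral (L1 - L2)) UNIV"
proof -
  have ftc: "(h has_integral (V b - V a)) {a..b}" if "a \<le> b" for a b
    by (rule fundamental_theorem_of_calculus[OF that has_vector_derivative_at_within[OF der]])
  have "h integrable_on cbox a b" for a b
    using ftc[of a b] by (cases "a \<le> b") (auto simp: integrable_on_def)
  moreover have "\<exists>B>0. \<forall>a b. ball 0 B \<subseteq> cbox a b \<longrightarrow> norm (integral (cbox a b) h - (L1 - L2)) < e" if "e > 0" for e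
  proof -
    have "\<forall>\<^sub>F x in at_top. dist (V x) L1 < e / 2"
      by (rule tendstoD[OF top]) (use that in simp)
    then obtain B1 where B1: "\<And>x. x \<ge> B1 \<Longrightarrow> dist (V x) L1 < e / 2"
      unfolding eventually_at_top_linorder by blast
    have "\<forall>\<^sub>F x in at_bot. dist (V x) L2 < e / 2"
      by (rule tendstoD[OF bot]) (use that in simp)
    then obtain B2 where B2: "\<And>x. x \<le> B2 \<Longrightarrow> dist (V x) L2 < e / 2"
      unfolding eventually_at_bot_linorder by blast
    define B where "B = \<bar>B1\<bar> + \<bar>B2\<bar> + 1"
    have "norm (integral (cbox a b) h - (L1 - L2)) < e" if ab: "ball 0 B \<subseteq> cbox a b" for a b
    proof -
      have B: "B > 0"
        by (simp add: B_def)
      then have "closure (ball 0 B) \<subseteq> cbox a b"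
        using ab by (intro closure_minimal closed_cbox)
      then have "B \<in> {a..b}" "- B \<in> {a..b}"
        using B by (auto simp: subset_iff dist_real_def)
      then have ab': "a \<le> b" "b \<ge> B1" "a \<le> B2"
        using B by (auto simp: B_def)
      have "norm (integral (cbox a b) h - (L1 - L2)) = norm ((V b - L1) - (V a - L2))"
        by (simp add: integral_unique[OF ftc[OF ab'(1)]] algebra_simps)
      also have "\<dots> \<le> dist (V b) L1 + dist (V a) L2"
        unfolding dist_norm by (rule norm_triangle_ineq4)
      also have "\<dots> < e"
        using B1[OF ab'(2)] B2[OF ab'(3)] by simp
      finally show ?thesis .
    qed
    then show ?thesis
      by (intro exI[of _ B]) (auto simp: B_def)
  qed
  ultimately show ?thesis
    unfolding has_integral_alt' by simp
qed

text \<open>The factor \<open>s\<close> cancels the stationary point of the phase at 0: \<open>s * exp (i b s\<^sup>2)\<close> is the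
  derivative of \<open>exp (i b s\<^sup>2) / (2 i b)\<close>, so one integration by parts gains \<open>1 / \<bar>b\<bar>\<close>.\<close>

lemma oscillatory_bound_C1:
  fixes P P' :: "real \<Rightarrow> complex"
  assumes uv: "u \<le> v" and P: "\<And>s. (P has_vector_derivative P' s) (at s)" and P': "continuous_on UNIV P'"
  shows "\<exists>K. \<forall>b. b \<noteq> 0 \<longrightarrow> norm (LINT s:{u..v}|lborel. (complex_of_real s * P s) * iexp (b * s\<^sup>2)) \<le> K / \<bar>b\<bar>"
proof -
  define K where "K = norm (P u) + norm (P v) + (LINT s:{u..v}|lborel. norm (P' s))"
  have Pc: "continuous_on UNIV P"
    using P by (auto intro!: continuous_at_imp_continuous_on has_vector_derivative_continuous)
  have "norm (LINT s:{u..v}|lborel. (complex_of_real s * P s) * iexp (b * s\<^sup>2)) \<le> K / \<bar>b\<bar>" if b: "b \<noteq> 0" for b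
  proof -
    define F where "F s = P s * iexp (b * s\<^sup>2)" for s
    define F1 where "F1 s = P' s * iexp (b * s\<^sup>2)" for s
    define F2 where "F2 s = (complex_of_real s * P s) * iexp (b * s\<^sup>2)" for s
    have eder: "((\<lambda>s. iexp (b * s\<^sup>2)) has_vector_derivative (2 * \<i> * b * s) * iexp (b * s\<^sup>2)) (at s)" for s
    proof -
      have "((\<lambda>s. \<i> * complex_of_real (b * s\<^sup>2)) has_vector_derivative \<i> * complex_of_real (b * (2 * s))) (at s)"
        by (intro has_vector_derivative_mult_right has_vector_derivative_of_real)
          (auto intro!: derivative_eq_intros simp: has_real_derivative_iff_has_vector_derivative[symmetric])
      from field_vector_diff_chain_at[OF this DERIV_exp]
      show ?thesis
        by (simp add: o_def mult_ac)
    qed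
    have Fder: "(F has_vector_derivative F1 s + 2 * \<i> * b * F2 s) (at s)" for s
      using has_vector_derivative_mult[OF P eder, of s]
      unfolding F_def[abs_def] F1_def F2_def by (simp add: algebra_simps)
    have c1: "continuous_on {u..v} F1" and c2: "continuous_on {u..v} F2"
      unfolding F1_def[abs_def] F2_def[abs_def]
      by (intro continuous_intros continuous_on_subset[OF P'] continuous_on_subset[OF Pc] subset_UNIV)+
    have i1: "set_integrable lborel {u..v} F1" and i2: "set_integrable lborel {u..v} F2"
      using c1 c2 by (auto intro: borel_integrable_atLeastAtMost')
    have "(LINT s:{u..v}|lborel. F1 s + 2 * \<i> * b * F2 s) = F v - F u"
    proof -
      have "has_bochner_integral lborel (\<lambda>s. indicator {u..v} s *\<^sub>R (F1 s + 2 * \<i> * b * F2 s)) (F v - F u)"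
        by (rule has_bochner_integral_FTC_Icc[OF uv has_vector_derivative_at_within[OF Fder]])
          (intro continuous_intros c1 c2)
      then show ?thesis
        unfolding set_lebesgue_integral_def by (rule has_bochner_integral_integral_eq)
    qed
    moreover have "(LINT s:{u..v}|lborel. F1 s + 2 * \<i> * b * F2 s) =
        (LINT s:{u..v}|lborel. F1 s) + 2 * \<i> * b * (LINT s:{u..v}|lborel. F2 s)"
      using set_integral_add(2)[OF i1 set_integrable_mult_right[OF i2, of "2 * \<i> * b"]]
      by (simp only: set_integral_mult_right)
    ultimately have "2 * \<i> * b * (LINT s:{u..v}|lborel. F2 s) = F v - F u - (LINT s:{u..v}|lborel. F1 s)"
      by (simp add: algebra_simps)
    then have "norm (2 * \<i> * b * (LINT s:{u..v}|lborel. F2 s)) \<le> norm (F v) + norm (F u) + norm (LINT s:{u..v}|lborel. F1 s)"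
      using norm_triangle_ineq4[of "F v - F u" "LINT s:{u..v}|lborel. F1 s"] norm_triangle_ineq4[of "F v" "F u"]
      by simp
    moreover have "norm (LINT s:{u..v}|lborel. F1 s) \<le> (LINT s:{u..v}|lborel. norm (P' s))"
      using set_integral_norm_bound[OF i1] by (simp add: F1_def norm_mult)
    moreover have "norm (F v) = norm (P v)" "norm (F u) = norm (P u)"
      by (auto simp: F_def norm_mult)
    moreover have "norm (2 * \<i> * b * (LINT s:{u..v}|lborel. F2 s)) = 2 * (\<bar>b\<bar> * norm (LINT s:{u..v}|lborel. F2 s))"
      by (simp add: norm_mult)
    moreover have "\<bar>b\<bar> * norm (LINT s:{u..v}|lborel. F2 s) \<ge> 0"
      by simp
    ultimately have "\<bar>b\<bar> * norm (LINT s:{u..v}|lborel. F2 s) \<le> K"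
      unfolding K_def by linarith
    then show ?thesis
      using b by (simp add: F2_def field_simps)
  qed
  then show ?thesis
    by blast
qed

text \<open>Away from the endpoints \<open>g s / s\<close> is continuous on a compact interval, hence uniformly close to
  a polynomial \<open>P\<close>, and the integral with \<open>s * P s\<close> in place of \<open>g\<close> is \<open>O(1 / \<bar>b\<bar>)\<close>.  The two
  end pieces contribute little because \<open>g\<close> is bounded.\<close>

lemma riemann_lebesgue_square:
  fixes g :: "real \<Rightarrow> complex"
  assumes u: "0 \<le> u" and [measurable]: "g \<in> borel_measurable borel"
    and B: "\<And>s. norm (g s) \<le> B" and cont: "continuous_on {u<..<v} g"
  shows "((\<lambda>b. LINT s:{u<..<v}|lborel. g s * iexp (b * s\<^sup>2)) \<longlongrightarrow> 0) at_infinity"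
proof (cases "u < v")
  case False
  then show ?thesis by (simp add: set_lebesgue_integral_def)
next
  case True
  have B0: "B \<ge> 0"
    using B[of 0] norm_ge_zero order_trans by blast
  show ?thesis
    unfolding Lim_at_infinity
  proof (intro allI impI)
    fix e :: real assume e: "e > 0"
    \<comment> \<open>the end pieces of length \<open>\<delta>\<close> cost at most \<open>2 * \<delta> * B\<close>, the approximation up to \<open>v * \<eta>\<close>
      costs at most \<open>(v - u) * v * \<eta>\<close>; each amount is at most \<open>e / 4\<close>\<close>
    define \<delta> where "\<delta> = min (e / (8 * (B + 1))) ((v - u) / 3)"
    define u' v' where "u' = u + \<delta>" and "v' = v - \<delta>"
    define \<eta> where "\<eta> = e / (4 * v * (v - u))"
    have \<delta>: "\<delta> > 0" "2 * \<delta> * B \<le> e / 4"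
    proof -
      show "\<delta> > 0" using True e B0 by (simp add: \<delta>_def)
      have "\<delta> \<le> e / (8 * (B + 1))" unfolding \<delta>_def by (rule min.cobounded1)
      then have "8 * (\<delta> * (B + 1)) \<le> e" using B0 by (simp add: field_simps)
      moreover have "\<delta> * B \<le> \<delta> * (B + 1)" using \<open>\<delta> > 0\<close> by simp
      ultimately show "2 * \<delta> * B \<le> e / 4" by linarith
    qed
    have uv': "0 < u'" "u < u'" "u' \<le> v'" "v' < v" "v > 0"
    proof -
      have "\<delta> \<le> (v - u) / 3" unfolding \<delta>_def by (rule min.cobounded2)
      then show "0 < u'" "u < u'" "u' \<le> v'" "v' < v" "v > 0"
        using \<delta>(1) u True by (auto simp: u'_def v'_def)
    qed
    have \<eta>: "\<eta> > 0"
      using e True uv' by (simp add: \<eta>_def)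
    have "continuous_on {u'..v'} (\<lambda>s. g s / complex_of_real s)"
      using uv' by (intro continuous_intros continuous_on_subset[OF cont]) auto
    then obtain P where P: "polynomial_function P" "\<And>s. s \<in> {u'..v'} \<Longrightarrow> norm (g s / complex_of_real s - P s) < \<eta>"
      using Stone_Weierstrass_polynomial_function[of "{u'..v'}" "\<lambda>s. g s / complex_of_real s" \<eta>] \<eta> by auto
    obtain P' where P': "polynomial_function P'" "\<And>s. (P has_vector_derivative P' s) (at s)"
      using has_vector_derivative_polynomial_function[OF P(1)] by blast
    have [measurable]: "P \<in> borel_measurable borel"
      using P(1) by (intro borel_measurable_continuous_onI continuous_on_polymonial_function)
    obtain K where K: "\<And>b. b \<noteq> 0 \<Longrightarrow>
        norm (LINT s:{u'..v'}|lborel. (complex_of_real s * P s) * iexp (b * s\<^sup>2)) \<le> K / \<bar>b\<bar>"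
      using oscillatory_bound_C1[OF uv'(3) P'(2) continuous_on_polymonial_function[OF P'(1)]] by blast
    have approx: "norm ((LINT s:{u<..<v}|lborel. g s * iexp (b * s\<^sup>2)) -
         (LINT s:{u'..v'}|lborel. (complex_of_real s * P s) * iexp (b * s\<^sup>2))) \<le> e / 2" for b
    proof -
      let ?A = "\<lambda>s. indicator {u<..<v} s *\<^sub>R (g s * iexp (b * s\<^sup>2))"
      let ?D = "\<lambda>s. indicator {u'..v'} s *\<^sub>R ((complex_of_real s * P s) * iexp (b * s\<^sup>2))"
      let ?M = "\<lambda>s. indicator {u..u'} s * B + indicator {v'..v} s * B + indicator {u'..v'} s * (v * \<eta>)"
      have "integrable lborel (\<lambda>s. indicator {u<..<v} s * B)"
        using True by (intro integrable_mult_left integrable_real_indicator) auto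
      then have iA: "integrable lborel ?A"
        by (rule Bochner_Integration.integrable_bound)
          (use B B0 in \<open>auto simp: indicator_def norm_mult\<close>)
      have iD: "integrable lborel ?D"
        using P(1) by (intro borel_integrable_compact continuous_intros continuous_on_polymonial_function) auto
      have iM: "integrable lborel ?M"
        using uv' by (intro Bochner_Integration.integrable_add integrable_mult_left integrable_real_indicator) auto
      have "norm ((\<integral>s. ?A s \<partial>lborel) - (\<integral>s. ?D s \<partial>lborel)) = norm (\<integral>s. ?A s - ?D s \<partial>lborel)"
        by (subst Bochner_Integration.integral_diff[OF iA iD]) simp
      also have "\<dots> \<le> (\<integral>s. ?M s \<partial>lborel)"
      proof (rule Bochner_Integration.integral_norm_bound_integral[OF Bochner_Integration.integrable_diff[OF iA iD] iM])
        fix s :: real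
        consider "s \<in> {u'..v'}" | "s \<in> {u<..<u'}" | "s \<in> {v'<..<v}" | "s \<notin> {u<..<v}"
          by force
        then show "norm (?A s - ?D s) \<le> ?M s"
        proof cases
          case 1
          then have s: "s > 0" "s \<le> v" "s \<in> {u<..<v}" using uv' by auto
          have "?A s - ?D s = complex_of_real s * (g s / complex_of_real s - P s) * iexp (b * s\<^sup>2)"
            using 1 s by (simp add: field_simps)
          then have "norm (?A s - ?D s) = s * norm (g s / complex_of_real s - P s)"
            using s by (simp add: norm_mult)
          also have "\<dots> \<le> v * \<eta>"
            using s P(2)[OF 1] by (intro mult_mono) auto
          also have "\<dots> \<le> ?M s"
            using 1 B0 by (simp add: indicator_def)
          finally show ?thesis .
        next
          case 2
          then have "norm (?A s - ?D s) \<le> B" using uv' B[of s] by (simp add: indicator_def norm_mult)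
          also have "\<dots> \<le> ?M s" using 2 B0 uv' \<eta> by (simp add: indicator_def)
          finally show ?thesis .
        next
          case 3
          then have "norm (?A s - ?D s) \<le> B" using uv' B[of s] by (simp add: indicator_def norm_mult)
          also have "\<dots> \<le> ?M s" using 3 B0 uv' \<eta> by (simp add: indicator_def)
          finally show ?thesis .
        next
          case 4
          then have "norm (?A s - ?D s) = 0" using uv' by (auto simp: indicator_def)
          also have "\<dots> \<le> ?M s" using B0 uv' \<eta> by (simp add: indicator_def)
          finally show ?thesis .
        qed
      qed
      also have "\<dots> = (u' - u) * B + (v - v') * B + (v' - u') * (v * \<eta>)"
      proof -
        have *: "has_bochner_integral lborel (\<lambda>s. indicator {a..b} s * C) ((b - a) * C)"
          if "a \<le> b" for a b C :: real
          using has_bochner_integral_mult_left[OF has_bochner_integral_real_indicator[of "{a..b}" lborel], of C] that by simp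
        show ?thesis
          by (rule has_bochner_integral_integral_eq)
            (intro has_bochner_integral_add *, use uv' in auto)
      qed
      also have "\<dots> \<le> 2 * \<delta> * B + (v - u) * (v * \<eta>)"
        using uv' \<eta> by (intro add_mono mult_right_mono) (auto simp: u'_def v'_def)
      also have "(v - u) * (v * \<eta>) = e / 4"
        using uv' True by (simp add: \<eta>_def field_simps)
      also have "2 * \<delta> * B + e / 4 \<le> e / 2"
        using \<delta>(2) by linarith
      finally show ?thesis
        by (simp add: set_lebesgue_integral_def)
    qed
    have "dist (LINT s:{u<..<v}|lborel. g s * iexp (b * s\<^sup>2)) 0 < e" if b: "norm b \<ge> (\<bar>K\<bar> + 1) * 4 / e" for b :: real
    proof -
      have b0: "\<bar>b\<bar> > 0"
        using b e by (smt (verit) divide_pos_pos real_norm_def)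
      have "K / \<bar>b\<bar> \<le> e / 4"
        using b b0 e by (simp add: field_simps)
      then have "norm (LINT s:{u'..v'}|lborel. (complex_of_real s * P s) * iexp (b * s\<^sup>2)) \<le> e / 4"
        by (rule order_trans[OF K, rotated]) (use b0 in auto)
      then show ?thesis
        using norm_triangle_sub[of "LINT s:{u<..<v}|lborel. g s * iexp (b * s\<^sup>2)"
            "LINT s:{u'..v'}|lborel. (complex_of_real s * P s) * iexp (b * s\<^sup>2)"] approx[of b] e
        by (simp add: dist_norm)
    qed
    then show "\<exists>N. \<forall>b::real. norm b \<ge> N \<longrightarrow> dist (LINT s:{u<..<v}|lborel. g s * iexp (b * s\<^sup>2)) 0 < e"
      by blast
  qed
qed

lemma even_integral_eq:
  fixes F :: "real \<Rightarrow> complex"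
  assumes F: "integrable lborel F" and even: "\<And>s. F (- s) = F s" and R: "R > 0" "\<And>s. s > R \<Longrightarrow> F s = 0"
  shows "(\<integral>s. F s \<partial>lborel) = 2 * (LINT s:{0..R}|lborel. F s)"
proof -
  let ?I = "\<lambda>s. indicator {0..R} s *\<^sub>R F s"
  have I: "integrable lborel ?I"
    by (rule integrable_mult_indicator[OF _ F]) simp
  have I': "integrable lborel (\<lambda>s. ?I (- s))"
    using lborel_integrable_real_affine[OF I, of "-1" 0] by simp
  have "(\<integral>s. F s \<partial>lborel) = (\<integral>s. ?I s + ?I (- s) \<partial>lborel)"
  proof (rule integral_cong_AE)
    have "F s = ?I s + ?I (- s)" if "s \<noteq> 0" for s
      using that R(2)[of s] R(2)[of "- s"] by (cases "s > 0") (auto simp: indicator_def even)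
    then show "AE s in lborel. F s = ?I s + ?I (- s)"
      using AE_lborel_singleton[of "0::real"] by (auto elim: eventually_mono)
  qed (use F I I' in auto)
  also have "\<dots> = (\<integral>s. ?I s \<partial>lborel) + (\<integral>s. ?I (- s) \<partial>lborel)"
    by (rule Bochner_Integration.integral_add[OF I I'])
  also have "(\<integral>s. ?I (- s) \<partial>lborel) = (\<integral>s. ?I s \<partial>lborel)"
    using lborel_integral_affine[of ?I "-1" 0] I by simp
  finally show ?thesis
    by (simp add: set_lebesgue_integral_def)
qed

lemma Si_at_bot: "(Si \<longlongrightarrow> - (pi / 2)) at_bot"
proof -
  have "((\<lambda>x. - Si (- x)) \<longlongrightarrow> - (pi / 2)) at_bot"
    by (intro tendsto_minus filterlim_compose[OF Si_at_top] filterlim_uminus_at_top_at_bot)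
  moreover have "\<forall>\<^sub>F x::real in at_bot. - Si (- x) = Si x"
    using eventually_le_at_bot[of 0]
  proof eventually_elim
    case (elim x)
    then show ?case using Si_neg[of "- x"] by simp
  qed
  ultimately show ?thesis
    by (rule Lim_transform_eventually)
qed

text \<open>In the variable \<open>\<sigma> = c * (s\<^sup>2 - p\<^sup>2)\<close> the integrand is \<open>exp (i \<gamma> \<sigma>) / c\<close>.  The upper limit
  \<open>m = sqrt 2 * p\<close> makes the range of \<open>\<sigma>\<close> the symmetric interval of radius \<open>c * p\<^sup>2\<close>, so that
  the sine contributions are odd and cancel, and the value is real.\<close>

lemma integral_linear_oscillation:
  assumes c: "c > 0" and m: "m \<ge> 0" "m\<^sup>2 = 2 * p\<^sup>2"
  shows "(LINT s:{0..m}|lborel. 2 * complex_of_real s * iexp (\<gamma> * (c * (s\<^sup>2 - p\<^sup>2)))) =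
         complex_of_real (2 / c * (c * p\<^sup>2 * sinc (c * p\<^sup>2 * \<gamma>)))"
proof (cases "\<gamma> = 0")
  case True
  have I: "has_bochner_integral lborel (\<lambda>s. indicator {0..m} s *\<^sub>R (2 * complex_of_real s)) (complex_of_real (m\<^sup>2) - complex_of_real (0\<^sup>2))"
  proof (rule has_bochner_integral_FTC_Icc[OF m(1)])
    show "((\<lambda>s. complex_of_real (s\<^sup>2)) has_vector_derivative 2 * complex_of_real s) (at s within {0..m})" for s
    proof -
      have "((\<lambda>s. s\<^sup>2) has_real_derivative 2 * s) (at s within {0..m})"
        by (auto intro!: derivative_eq_intros)
      from has_vector_derivative_of_real[OF this] show ?thesis by simp
    qed
  qed (intro continuous_intros)
  have "(LINT s:{0..m}|lborel. 2 * complex_of_real s * iexp (\<gamma> * (c * (s\<^sup>2 - p\<^sup>2)))) =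
        (LINT s:{0..m}|lborel. 2 * complex_of_real s)"
    by (simp only: True mult_zero_left of_real_0 mult_zero_right exp_zero mult_1_right)
  also have "\<dots> = complex_of_real (m\<^sup>2) - complex_of_real (0\<^sup>2)"
    unfolding set_lebesgue_integral_def by (rule has_bochner_integral_integral_eq[OF I])
  finally show ?thesis
    using True c m(2) by simp
next
  case False
  let ?e = "\<lambda>s. iexp (\<gamma> * (c * (s\<^sup>2 - p\<^sup>2)))"
  have "has_bochner_integral lborel (\<lambda>s. indicator {0..m} s *\<^sub>R (2 * complex_of_real s * ?e s))
      (?e m / (\<i> * (\<gamma> * c)) - ?e 0 / (\<i> * (\<gamma> * c)))"
  proof (rule has_bochner_integral_FTC_Icc[OF m(1)])
    fix s
    have "((\<lambda>s. \<i> * complex_of_real (\<gamma> * (c * (s\<^sup>2 - p\<^sup>2)))) has_vector_derivative \<i> * complex_of_real (\<gamma> * (c * (2 * s)))) (at s)"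
      by (intro has_vector_derivative_mult_right has_vector_derivative_of_real)
        (auto intro!: derivative_eq_intros simp: has_real_derivative_iff_has_vector_derivative[symmetric])
    from field_vector_diff_chain_at[OF this DERIV_exp]
    have "(?e has_vector_derivative (\<i> * complex_of_real (\<gamma> * (c * (2 * s)))) * ?e s) (at s)"
      by (simp add: o_def)
    from has_vector_derivative_divide[OF this, of "\<i> * (\<gamma> * c)"]
    have "((\<lambda>s. ?e s / (\<i> * (\<gamma> * c))) has_vector_derivative 2 * complex_of_real s * ?e s) (at s)"
      using False c by (simp add: field_simps)
    then show "((\<lambda>s. ?e s / (\<i> * (\<gamma> * c))) has_vector_derivative 2 * complex_of_real s * ?e s) (at s within {0..m})"
      by (rule has_vector_derivative_at_within)
  qed (intro continuous_intros)
  then have "(LINT s:{0..m}|lborel. 2 * complex_of_real s * ?e s) = (?e m - ?e 0) / (\<i> * (\<gamma> * c))"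
    unfolding set_lebesgue_integral_def by (simp add: has_bochner_integral_integral_eq diff_divide_distrib)
  also have "m\<^sup>2 - p\<^sup>2 = p\<^sup>2"
    using m(2) by simp
  also have "?e 0 = iexp (- (c * p\<^sup>2 * \<gamma>))"
    by (simp add: mult_ac)
  also have "\<gamma> * (c * p\<^sup>2) = c * p\<^sup>2 * \<gamma>"
    by simp
  also have "iexp (c * p\<^sup>2 * \<gamma>) - iexp (- (c * p\<^sup>2 * \<gamma>)) = 2 * \<i> * sin (c * p\<^sup>2 * \<gamma>)"
    by (simp add: complex_eq_iff Re_exp Im_exp)
  also have "2 * \<i> * sin (c * p\<^sup>2 * \<gamma>) / (\<i> * (\<gamma> * c)) =
      complex_of_real (2 / c * (c * p\<^sup>2 * sinc (c * p\<^sup>2 * \<gamma>)))"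
    using False c by (cases "p = 0") (simp_all add: field_simps)
  finally show ?thesis .
qed

text \<open>In the variable \<open>\<tau> = s\<^sup>2\<close> this is one-dimensional Fourier inversion at \<open>\<tau> = p\<^sup>2\<close> for the
  function \<open>\<phi> (sqrt \<tau>) / sqrt \<tau>\<close>, which has a singularity at 0 and in general a transform that
  decays only like \<open>\<bar>\<gamma>\<bar> powr (-1/2)\<close>.  Dirichlet's argument still applies.  On \<open>s \<le> m\<close> subtract
  from \<open>\<phi> s\<close> the linear function \<open>\<kappa> * s\<close> with the same value at \<open>p\<close>.  Its contribution is a multiple of \<open>sinc\<close>
  with primitive \<open>Si\<close>, whose limits at the two ends differ by \<open>pi\<close>.  The remainder \<open>q0\<close> vanishes
  at \<open>p\<close>, where \<open>\<phi>\<close> is differentiable, so that dividing it by the phase leaves a bounded function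
  \<open>\<Psi>\<close>; the primitive of its contribution is the oscillatory integral \<open>W\<close> of \<open>\<Psi>\<close>, which tends to 0
  at both ends by the Riemann-Lebesgue lemma.\<close>

theorem radial_fourier_inversion:
  fixes \<phi> :: "real \<Rightarrow> complex"
  assumes cont: "continuous_on UNIV \<phi>" and even: "\<And>s. \<phi> (- s) = \<phi> s"
    and supp: "\<And>s. \<bar>s\<bar> > r \<Longrightarrow> \<phi> s = 0"
    and der: "(\<phi> has_vector_derivative d) (at p)" and p: "p > 0" and c: "c > 0"
  shows "((\<lambda>\<gamma>. \<integral>s. \<phi> s * iexp (\<gamma> * (c * (s\<^sup>2 - p\<^sup>2))) \<partial>lborel) has_integral
           complex_of_real (2 * pi / (c * p)) * \<phi> p) UNIV"
proof -
  define m where "m = sqrt 2 * p"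
  define R where "R = max r m + 1"
  define \<kappa> where "\<kappa> = \<phi> p / p"
  \<comment> \<open>\<open>V\<close> is the primitive of the integrand whose limits give the integral; division by 0 makes
    \<open>\<Psi> p = 0\<close>, which is harmless since \<open>q0 p = 0\<close>\<close>
  define q0 where "q0 s = \<phi> s - (if s \<le> m then \<kappa> * s else 0)" for s
  define \<Psi> where "\<Psi> s = 2 * q0 s / complex_of_real (c * (s\<^sup>2 - p\<^sup>2))" for s
  let ?e = "\<lambda>\<gamma> s. iexp (\<gamma> * (c * (s\<^sup>2 - p\<^sup>2)))"
  define W where "W \<gamma> = (LINT s:{0..R}|lborel. \<Psi> s / \<i> * ?e \<gamma> s)" for \<gamma>
  define V where "V \<gamma> = \<kappa> * complex_of_real (2 / c * Si (c * p\<^sup>2 * \<gamma>)) + W \<gamma>" for \<gamma>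
  have m: "p < m" "m > 0" "m\<^sup>2 = 2 * p\<^sup>2"
    using p by (auto simp: m_def power_mult_distrib)
  then have m: "p < m" "m > 0" "m\<^sup>2 = 2 * p\<^sup>2" "m < R" "r < R" "R > 0"
    by (auto simp: R_def)
  have [measurable]: "\<phi> \<in> borel_measurable borel"
    using cont by (rule borel_measurable_continuous_onI)
  have [measurable]: "q0 \<in> borel_measurable borel" "\<Psi> \<in> borel_measurable borel"
    unfolding q0_def[abs_def] \<Psi>_def[abs_def] by measurable
  obtain M where M: "M \<ge> 0" "\<And>s. norm (\<phi> s) \<le> M"
  proof -
    have "compact (\<phi> ` {-r..r})"
      by (intro compact_continuous_image continuous_on_subset[OF cont]) auto
    then obtain B where B: "\<forall>y\<in>\<phi> ` {-r..r}. norm y \<le> B"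
      using compact_imp_bounded bounded_iff by blast
    have "norm (\<phi> s) \<le> max B 0" for s
    proof (cases "\<bar>s\<bar> > r")
      case False
      then have "s \<in> {-r..r}" by auto
      then show ?thesis
        using B by (auto intro: max.coboundedI1)
    qed (simp add: supp)
    then show ?thesis
      using that[of "max B 0"] by auto
  qed
  define N where "N = M + norm \<kappa> * m"
  have N: "N \<ge> 0"
    using M m by (simp add: N_def)
  have q0_bound: "norm (q0 s) \<le> N" if "s \<ge> 0" for s
  proof -
    have "norm (if s \<le> m then \<kappa> * s else 0) \<le> norm \<kappa> * m"
      using that m by (auto simp: norm_mult intro!: mult_left_mono)
    then show ?thesis
      unfolding q0_def N_def by (intro norm_triangle_le_diff add_mono M)
  qed
  obtain B where B: "\<And>s. s \<in> {0..R} \<Longrightarrow> norm (\<Psi> s) \<le> B"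
  proof -
    obtain \<delta> where \<delta>: "\<delta> > 0" "\<And>s. \<bar>s - p\<bar> < \<delta> \<Longrightarrow> norm (q0 s) \<le> (norm (d - \<kappa>) + 1) * \<bar>s - p\<bar>"
    proof -
      have "((\<lambda>s. \<phi> s - \<kappa> * complex_of_real s) has_vector_derivative d - \<kappa> * complex_of_real 1) (at p)"
        by (intro has_vector_derivative_diff der has_vector_derivative_mult_right has_vector_derivative_of_real DERIV_ident)
      then have "((\<lambda>s. \<phi> s - \<kappa> * complex_of_real s) has_derivative (\<lambda>h. h *\<^sub>R (d - \<kappa>))) (at p)"
        by (simp add: has_vector_derivative_def)
      then obtain \<delta> where \<delta>: "\<delta> > 0" "\<And>s. norm (s - p) < \<delta> \<Longrightarrow>
         norm ((\<phi> s - \<kappa> * complex_of_real s) - (\<phi> p - \<kappa> * complex_of_real p) - (s - p) *\<^sub>R (d - \<kappa>)) \<le> 1 * norm (s - p)"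
        unfolding has_derivative_at_alt by (metis zero_less_one)
      have "norm (q0 s) \<le> (norm (d - \<kappa>) + 1) * \<bar>s - p\<bar>" if s: "\<bar>s - p\<bar> < min \<delta> (m - p)" for s
      proof -
        have "q0 s = \<phi> s - \<kappa> * s" "\<phi> p - \<kappa> * p = 0"
          using s p by (auto simp: q0_def \<kappa>_def)
        then have "norm (q0 s - (s - p) *\<^sub>R (d - \<kappa>)) \<le> \<bar>s - p\<bar>"
          using \<delta>(2)[of s] s by simp
        then have "norm (q0 s) \<le> \<bar>s - p\<bar> + norm ((s - p) *\<^sub>R (d - \<kappa>))"
          using norm_triangle_sub[of "q0 s" "(s - p) *\<^sub>R (d - \<kappa>)"] by linarith
        then show ?thesis
          by (simp add: distrib_left distrib_right add.commute mult.commute)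
      qed
      then show ?thesis
        using \<delta>(1) m by (intro that[of "min \<delta> (m - p)"]) auto
    qed
    \<comment> \<open>near \<open>p\<close> the factor \<open>\<bar>s - p\<bar>\<close> cancels; elsewhere the denominator is at least \<open>c * \<delta> * p\<close>\<close>
    define B where "B = max (2 * (norm (d - \<kappa>) + 1) / (c * p)) (2 * N / (c * (\<delta> * p)))"
    have "norm (\<Psi> s) \<le> B" if s: "s \<in> {0..R}" for s
    proof (cases "s = p")
      case True
      then show ?thesis
        using p c N \<delta> by (auto simp: \<Psi>_def B_def le_max_iff_disj)
    next
      case False
      have sq: "\<bar>c * (s\<^sup>2 - p\<^sup>2)\<bar> = c * (\<bar>s - p\<bar> * (s + p))"
        using s p c by (simp add: power2_eq_square square_diff_square_factored abs_mult)
      have nP: "norm (\<Psi> s) = 2 * norm (q0 s) / (c * (\<bar>s - p\<bar> * (s + p)))"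
        unfolding \<Psi>_def by (simp only: norm_divide norm_mult norm_of_real sq) simp
      have sp: "s + p \<ge> p" "\<bar>s - p\<bar> > 0"
        using s False by auto
      show ?thesis
      proof (cases "\<bar>s - p\<bar> < \<delta>")
        case True
        have "norm (\<Psi> s) \<le> 2 * ((norm (d - \<kappa>) + 1) * \<bar>s - p\<bar>) / (c * (\<bar>s - p\<bar> * p))"
          unfolding nP using \<delta>(2)[OF True] sp p c by (intro frac_le mult_left_mono mult_pos_pos) auto
        also have "\<dots> = 2 * (norm (d - \<kappa>) + 1) / (c * p)"
          using sp by simp
        finally show ?thesis by (simp add: B_def)
      next
        case False
        have "norm (\<Psi> s) \<le> 2 * N / (c * (\<delta> * p))"
          unfolding nP using q0_bound[of s] s False \<delta>(1) sp p c N
          by (intro frac_le mult_left_mono mult_mono mult_pos_pos) auto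
        then show ?thesis by (simp add: B_def)
      qed
    qed
    then show ?thesis by (rule that)
  qed
  have q0_\<Psi>: "2 * q0 s = \<Psi> s * complex_of_real (c * (s\<^sup>2 - p\<^sup>2))" if "s \<ge> 0" for s
  proof (cases "s = p")
    case True
    then show ?thesis using p m by (simp add: q0_def \<kappa>_def)
  next
    case False
    then have "c * (s\<^sup>2 - p\<^sup>2) \<noteq> 0"
      using c p that by (simp add: power2_eq_iff)
    then show ?thesis
      unfolding \<Psi>_def by (metis nonzero_eq_divide_eq of_real_eq_0_iff)
  qed
  have bounded_int: "integrable lborel (\<lambda>s. indicator {0..b} s *\<^sub>R g s)"
    if [measurable]: "g \<in> borel_measurable borel" and "\<And>s. s \<in> {0..b} \<Longrightarrow> norm (g s) \<le> K" for b K and g :: "real \<Rightarrow> complex"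
  proof -
    have "integrable lborel (\<lambda>s. indicator {0..b} s * K)"
      by (intro integrable_mult_left integrable_real_indicator emeasure_bounded_finite) auto
    then show ?thesis
    proof (rule Bochner_Integration.integrable_bound)
      show "AE s in lborel. norm (indicator {0..b} s *\<^sub>R g s) \<le> norm (indicator {0..b} s * K)"
      proof (rule AE_I2)
        show "norm (indicator {0..b} s *\<^sub>R g s) \<le> norm (indicator {0..b} s * K)" for s
          using that(2)[of s] by (cases "s \<in> {0..b}") auto
      qed
    qed measurable
  qed
  have e_meas [measurable]: "?e \<gamma> \<in> borel_measurable borel" for \<gamma>
    by (intro borel_measurable_continuous_onI continuous_intros)
  have intphi: "integrable lborel (\<lambda>s. indicator {0..R} s *\<^sub>R (\<phi> s * ?e \<gamma> s))" for \<gamma>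
    by (rule bounded_int[where K = M]) (use M in \<open>auto simp: norm_mult\<close>)
  have intq: "integrable lborel (\<lambda>s. indicator {0..R} s *\<^sub>R (2 * q0 s * ?e \<gamma> s))" for \<gamma>
    by (rule bounded_int[where K = "2 * N"]) (use q0_bound in \<open>auto simp: norm_mult\<close>)
  have intlin: "integrable lborel (\<lambda>s. indicator {0..m} s *\<^sub>R (2 * complex_of_real s * ?e \<gamma> s))" for \<gamma>
    by (rule bounded_int[where K = "2 * m"]) (auto simp: norm_mult)
  have H: "(\<integral>s. \<phi> s * ?e \<gamma> s \<partial>lborel) =
      \<kappa> * complex_of_real (2 / c * (c * p\<^sup>2 * sinc (c * p\<^sup>2 * \<gamma>))) + (LINT s:{0..R}|lborel. 2 * q0 s * ?e \<gamma> s)" for \<gamma>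
  proof -
    have "integrable lborel (\<lambda>s. indicator {-\<bar>r\<bar>..\<bar>r\<bar>} s *\<^sub>R (\<phi> s * ?e \<gamma> s))"
      by (intro borel_integrable_compact continuous_intros continuous_on_subset[OF cont]) auto
    also have "(\<lambda>s. indicator {-\<bar>r\<bar>..\<bar>r\<bar>} s *\<^sub>R (\<phi> s * ?e \<gamma> s)) = (\<lambda>s. \<phi> s * ?e \<gamma> s)"
      using supp by (fastforce simp: indicator_def fun_eq_iff abs_if)
    finally have "(\<integral>s. \<phi> s * ?e \<gamma> s \<partial>lborel) = 2 * (LINT s:{0..R}|lborel. \<phi> s * ?e \<gamma> s)"
      by (rule even_integral_eq) (use even supp m in auto)
    also have "\<dots> = (\<integral>s. 2 * (indicator {0..R} s *\<^sub>R (\<phi> s * ?e \<gamma> s)) \<partial>lborel)"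
      unfolding set_lebesgue_integral_def by (rule integral_mult_right_zero[symmetric])
    also have "\<dots> = (\<integral>s. \<kappa> * (indicator {0..m} s *\<^sub>R (2 * complex_of_real s * ?e \<gamma> s)) +
        indicator {0..R} s *\<^sub>R (2 * q0 s * ?e \<gamma> s) \<partial>lborel)"
      using m by (intro Bochner_Integration.integral_cong refl) (auto simp: indicator_def q0_def algebra_simps)
    also have "\<dots> = \<kappa> * (LINT s:{0..m}|lborel. 2 * complex_of_real s * ?e \<gamma> s) + (LINT s:{0..R}|lborel. 2 * q0 s * ?e \<gamma> s)"
      unfolding set_lebesgue_integral_def
      by (subst Bochner_Integration.integral_add[OF integrable_mult_right[OF intlin] intq])
        (simp only: integral_mult_right_zero)
    finally show ?thesis
      using integral_linear_oscillation[OF c _ m(3)] m(2) by simp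
  qed
  have Wder: "(W has_vector_derivative (LINT s:{0..R}|lborel. 2 * q0 s * ?e \<gamma> s)) (at \<gamma>)" for \<gamma>
    unfolding W_def[abs_def] set_lebesgue_integral_def
  proof (rule has_vector_derivative_integral[where r = 1 and g = "\<lambda>s. indicator {0..R} s * (2 * N)"])
    show "integrable lborel (\<lambda>s. indicator {0..R} s *\<^sub>R (\<Psi> s / \<i> * ?e \<gamma>' s))" for \<gamma>'
      by (rule bounded_int[where K = B]) (use B in \<open>auto simp: norm_mult norm_divide\<close>)
    show "((\<lambda>\<gamma>. indicator {0..R} s *\<^sub>R (\<Psi> s / \<i> * ?e \<gamma> s)) has_vector_derivative
        indicator {0..R} s *\<^sub>R (2 * q0 s * ?e \<gamma>' s)) (at \<gamma>')" for s \<gamma>'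
    proof (cases "s \<in> {0..R}")
      case True
      define w where "w = c * (s\<^sup>2 - p\<^sup>2)"
      have "((\<lambda>\<gamma>. \<i> * complex_of_real (\<gamma> * w)) has_vector_derivative \<i> * complex_of_real w) (at \<gamma>')"
        by (intro has_vector_derivative_mult_right has_vector_derivative_of_real)
          (auto intro!: derivative_eq_intros simp: has_real_derivative_iff_has_vector_derivative[symmetric])
      from field_vector_diff_chain_at[OF this DERIV_exp]
      have "((\<lambda>\<gamma>. iexp (\<gamma> * w)) has_vector_derivative \<i> * complex_of_real w * iexp (\<gamma>' * w)) (at \<gamma>')"
        by (simp add: o_def)
      from has_vector_derivative_mult_right[OF this, of "\<Psi> s / \<i>"]
      have "((\<lambda>\<gamma>. \<Psi> s / \<i> * iexp (\<gamma> * w)) has_vector_derivative \<Psi> s * complex_of_real w * iexp (\<gamma>' * w)) (at \<gamma>')"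
        by (simp add: mult_ac)
      moreover have "2 * q0 s = \<Psi> s * complex_of_real w"
        using q0_\<Psi>[of s] True by (simp add: w_def)
      ultimately show ?thesis
        using True by (simp add: w_def)
    qed simp
    show "norm (indicator {0..R} s *\<^sub>R (2 * q0 s * ?e \<gamma>' s)) \<le> indicator {0..R} s * (2 * N)" for s \<gamma>'
      using q0_bound[of s] by (auto simp: indicator_def norm_mult)
    show "integrable lborel (\<lambda>s. indicator {0..R} s * (2 * N))"
      by (intro integrable_mult_left integrable_real_indicator emeasure_bounded_finite) auto
  qed simp
  have Vder: "(V has_vector_derivative (\<integral>s. \<phi> s * ?e \<gamma> s \<partial>lborel)) (at \<gamma>)" for \<gamma>
  proof -
    have "((\<lambda>\<gamma>. 2 / c * Si (c * p\<^sup>2 * \<gamma>)) has_real_derivative 2 / c * (c * p\<^sup>2 * sinc (c * p\<^sup>2 * \<gamma>))) (at \<gamma>)"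
      by (rule derivative_eq_intros DERIV_chain2[OF DERIV_Si] refl | simp)+
    then have "((\<lambda>\<gamma>. \<kappa> * complex_of_real (2 / c * Si (c * p\<^sup>2 * \<gamma>))) has_vector_derivative
        \<kappa> * complex_of_real (2 / c * (c * p\<^sup>2 * sinc (c * p\<^sup>2 * \<gamma>)))) (at \<gamma>)"
      by (intro has_vector_derivative_mult_right has_vector_derivative_of_real)
    then show ?thesis
      unfolding H V_def[abs_def] by (rule has_vector_derivative_add[OF _ Wder])
  qed
  have W0: "(W \<longlongrightarrow> 0) at_infinity"
  proof (rule tendsto_norm_zero_cancel)
    \<comment> \<open>\<open>\<Psi>\<close> can be discontinuous at \<open>p\<close>, by its default value, and at the cut-off \<open>m\<close>, so the
      interval is split at these two points\<close>
    define g where "g s = indicator {0..R} s *\<^sub>R \<Psi> s" for s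
    have [measurable]: "g \<in> borel_measurable borel"
      unfolding g_def[abs_def] by measurable
    have gB: "norm (g s) \<le> \<bar>B\<bar>" for s
      using B[of s] by (auto simp: g_def indicator_def)
    let ?L = "\<lambda>u v b. LINT s:{u<..<v}|lborel. g s * iexp (b * s\<^sup>2)"
    have \<Psi>c: "continuous_on {u<..<v} g" if "0 \<le> u" "v \<le> R" "p \<notin> {u<..<v}" "m \<notin> {u<..<v}" for u v
    proof -
      have ne: "complex_of_real (c * (s\<^sup>2 - p\<^sup>2)) \<noteq> 0" if s: "s \<in> {u<..<v}" for s
      proof -
        have "s \<noteq> p" "s > 0" using s \<open>0 \<le> u\<close> \<open>p \<notin> {u<..<v}\<close> by auto
        then have "c * (s\<^sup>2 - p\<^sup>2) \<noteq> 0"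
          using c p by (simp add: power2_eq_iff)
        then show ?thesis by (simp only: of_real_eq_0_iff not_False_eq_True)
      qed
      have "continuous_on {u<..<v} q0"
      proof (cases "v \<le> m")
        case True
        have "continuous_on {u<..<v} (\<lambda>s. \<phi> s - \<kappa> * s)"
          by (intro continuous_intros continuous_on_subset[OF cont]) auto
        then show ?thesis
          by (rule continuous_on_eq) (use True in \<open>auto simp: q0_def\<close>)
      next
        case False
        show ?thesis
          by (rule continuous_on_eq[OF continuous_on_subset[OF cont]])
            (use False \<open>m \<notin> {u<..<v}\<close> in \<open>auto simp: q0_def\<close>)
      qed
      then have "continuous_on {u<..<v} \<Psi>"
        unfolding \<Psi>_def[abs_def] using ne by (intro continuous_intros) auto
      then show ?thesis
        by (rule continuous_on_eq) (use that in \<open>auto simp: g_def\<close>)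
    qed
    have cinf: "filterlim (\<lambda>\<gamma>. \<gamma> * c) at_infinity at_infinity"
      using tendsto_mult_filterlim_at_infinity[OF tendsto_const _ filterlim_ident, of c] c
      by (simp add: mult.commute)
    have "((\<lambda>b. ?L 0 p b + ?L p m b + ?L m R b) \<longlongrightarrow> 0 + 0 + 0) at_infinity"
      using m p by (intro tendsto_add riemann_lebesgue_square[OF _ _ gB \<Psi>c]) auto
    then have "((\<lambda>b. norm (?L 0 p b + ?L p m b + ?L m R b)) \<longlongrightarrow> 0) at_infinity"
      by (intro tendsto_norm_zero) simp
    from filterlim_compose[OF this cinf]
    have "((\<lambda>\<gamma>. norm (?L 0 p (\<gamma> * c) + ?L p m (\<gamma> * c) + ?L m R (\<gamma> * c))) \<longlongrightarrow> 0) at_infinity" .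
    moreover have "norm (?L 0 p (\<gamma> * c) + ?L p m (\<gamma> * c) + ?L m R (\<gamma> * c)) = norm (W \<gamma>)" for \<gamma>
    proof -
      let ?h = "\<lambda>s. g s * iexp (\<gamma> * c * s\<^sup>2)"
      have int: "integrable lborel (\<lambda>s. indicator {u<..<v} s *\<^sub>R ?h s)" for u v
      proof -
        have "integrable lborel ?h"
          using bounded_int[of "\<lambda>s. \<Psi> s * iexp (\<gamma> * c * s\<^sup>2)" R B] B by (simp add: norm_mult g_def)
        then show ?thesis by (intro integrable_mult_indicator) simp_all
      qed
      have "?L 0 p (\<gamma> * c) + ?L p m (\<gamma> * c) + ?L m R (\<gamma> * c) =
          (\<integral>s. indicator {0<..<p} s *\<^sub>R ?h s + indicator {p<..<m} s *\<^sub>R ?h s + indicator {m<..<R} s *\<^sub>R ?h s \<partial>lborel)"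
        unfolding set_lebesgue_integral_def
        by (simp only: Bochner_Integration.integral_add int Bochner_Integration.integrable_add)
      also have "\<dots> = (\<integral>s. \<i> * iexp (\<gamma> * c * p\<^sup>2) * (indicator {0..R} s *\<^sub>R (\<Psi> s / \<i> * ?e \<gamma> s)) \<partial>lborel)"
      proof (rule integral_cong_AE)
        have eq: "indicator {0<..<p} s *\<^sub>R ?h s + indicator {p<..<m} s *\<^sub>R ?h s + indicator {m<..<R} s *\<^sub>R ?h s =
           \<i> * iexp (\<gamma> * c * p\<^sup>2) * (indicator {0..R} s *\<^sub>R (\<Psi> s / \<i> * ?e \<gamma> s))"
          if "s \<noteq> 0" "s \<noteq> p" "s \<noteq> m" "s \<noteq> R" for s
        proof -
          have "iexp (\<gamma> * c * p\<^sup>2) * ?e \<gamma> s = iexp (\<gamma> * c * s\<^sup>2)"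
            by (simp add: exp_add[symmetric] algebra_simps)
          then have "\<i> * iexp (\<gamma> * c * p\<^sup>2) * (indicator {0..R} s *\<^sub>R (\<Psi> s / \<i> * ?e \<gamma> s)) = ?h s"
            by (simp add: g_def scaleR_conv_of_real mult_ac)
          moreover have "indicator {0<..<p} s *\<^sub>R ?h s + indicator {p<..<m} s *\<^sub>R ?h s + indicator {m<..<R} s *\<^sub>R ?h s = ?h s"
            using that m p by (auto simp: indicator_def g_def)
          ultimately show ?thesis by simp
        qed
        show "AE s in lborel. indicator {0<..<p} s *\<^sub>R ?h s + indicator {p<..<m} s *\<^sub>R ?h s + indicator {m<..<R} s *\<^sub>R ?h s =
           \<i> * iexp (\<gamma> * c * p\<^sup>2) * (indicator {0..R} s *\<^sub>R (\<Psi> s / \<i> * ?e \<gamma> s))"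
          using AE_lborel_singleton[of 0] AE_lborel_singleton[of p] AE_lborel_singleton[of m] AE_lborel_singleton[of R]
        proof eventually_elim
          case (elim s)
          then show ?case by (rule eq)
        qed
      qed measurable
      also have "\<dots> = \<i> * iexp (\<gamma> * c * p\<^sup>2) * W \<gamma>"
        unfolding W_def set_lebesgue_integral_def by (rule integral_mult_right_zero)
      finally have "norm (?L 0 p (\<gamma> * c) + ?L p m (\<gamma> * c) + ?L m R (\<gamma> * c)) = norm (\<i> * iexp (\<gamma> * c * p\<^sup>2) * W \<gamma>)"
        by (rule arg_cong)
      then show ?thesis
        by (simp only: norm_mult norm_ii norm_exp_i_times mult_1)
    qed
    ultimately show "((\<lambda>\<gamma>. norm (W \<gamma>)) \<longlongrightarrow> 0) at_infinity"
      by simp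
  qed
  have T: "c * p\<^sup>2 > 0"
    using c p by simp
  have Vtop: "(V \<longlongrightarrow> \<kappa> * complex_of_real (2 / c * (pi / 2)) + 0) at_top"
    unfolding V_def[abs_def]
    by (intro tendsto_add tendsto_mult tendsto_const tendsto_of_real filterlim_compose[OF Si_at_top]
        filterlim_tendsto_pos_mult_at_top[OF tendsto_const T] filterlim_ident
        tendsto_mono[OF at_top_le_at_infinity W0])
  have Vbot: "(V \<longlongrightarrow> \<kappa> * complex_of_real (2 / c * - (pi / 2)) + 0) at_bot"
    unfolding V_def[abs_def]
    by (intro tendsto_add tendsto_mult tendsto_const tendsto_of_real filterlim_compose[OF Si_at_bot]
        filterlim_tendsto_pos_mult_at_bot[OF tendsto_const T] filterlim_ident
        tendsto_mono[OF at_bot_le_at_infinity W0])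
  have "\<kappa> * complex_of_real (2 / c * (pi / 2)) + 0 - (\<kappa> * complex_of_real (2 / c * - (pi / 2)) + 0) =
      complex_of_real (2 * pi / (c * p)) * \<phi> p"
    using c p by (simp add: \<kappa>_def field_simps)
  then show ?thesis
    using has_integral_UNIV_of_primitive[OF Vder Vtop Vbot] by simp
qed

section \<open>Inversion of the elliptical Radon transform\<close>

lemma nu_pos: "lam > 1 \<Longrightarrow> nu lam > 0"
  by (simp add: nu_def)

lemma nu_le: "lam > 1 \<Longrightarrow> nu lam \<le> lam"
  by (simp add: nu_def real_le_lsqrt)

lemma semiaxis_pos: "lam > 1 \<Longrightarrow> semiaxis k lam j > 0"
  by (simp add: semiaxis_def nu_pos)

lemma semiaxis_le: "lam > 1 \<Longrightarrow> semiaxis k lam j \<le> lam"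
  by (simp add: semiaxis_def nu_le)

lemma ell_form_eq_sum:
  "ell_form k lam y yn = (\<Sum>j\<in>UNIV. (y $ j / semiaxis k lam j)\<^sup>2) + (yn / nu lam)\<^sup>2"
proof -
  have "(\<Sum>j\<in>UNIV. (y $ j / semiaxis k lam j)\<^sup>2) =
      (y $ k / semiaxis k lam k)\<^sup>2 + (\<Sum>j\<in>UNIV - {k}. (y $ j / semiaxis k lam j)\<^sup>2)"
    by (rule sum.remove) auto
  also have "(\<Sum>j\<in>UNIV - {k}. (y $ j / semiaxis k lam j)\<^sup>2) = (\<Sum>j\<in>UNIV - {k}. (y $ j)\<^sup>2) / (nu lam)\<^sup>2"
    by (subst sum_divide_distrib) (auto simp: semiaxis_def power_divide intro!: sum.cong)
  finally show ?thesis
    by (simp add: ell_form_def semiaxis_def power_divide)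
qed

lemma prod_semiaxis:
  fixes k :: "'m::finite"
  shows "(\<Prod>j\<in>UNIV. semiaxis k lam j) = lam * nu lam ^ (CARD('m) - 1)"
proof -
  have "(\<Prod>j\<in>UNIV. semiaxis k lam j) = semiaxis k lam k * (\<Prod>j\<in>UNIV - {k}. semiaxis k lam j)"
    by (rule prod.remove) auto
  also have "(\<Prod>j\<in>UNIV - {k}. semiaxis k lam j) = (\<Prod>j\<in>UNIV - {k}. nu lam)"
    by (rule prod.cong) (auto simp: semiaxis_def)
  finally show ?thesis
    by (simp add: semiaxis_def card_Diff_singleton)
qed

lemma norm_vec_power2: "(norm y)\<^sup>2 = (\<Sum>j\<in>UNIV. (y $ j)\<^sup>2)" for y :: "real ^ 'm::finite"
  unfolding power2_norm_eq_inner inner_vec_def by (simp add: power2_eq_square)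

definition ell_gauge :: "'m::finite \<Rightarrow> real \<Rightarrow> (real ^ 'm) \<times> real \<Rightarrow> real" where
  "ell_gauge k lam z = ell_form k lam (fst z) (snd z)"

text \<open>The lower bound holds with constant \<open>1 / lam\<^sup>2\<close> because no semiaxis exceeds \<open>lam\<close>.\<close>

lemma ell_gauge_quadratic:
  assumes lam: "lam > 1"
  shows "quadratic_gauge (ell_gauge k lam) (1 / lam\<^sup>2)"
proof
  show "continuous_on UNIV (ell_gauge k lam)"
    unfolding ell_gauge_def[abs_def] ell_form_eq_sum
    using semiaxis_pos[OF lam, of k] nu_pos[OF lam] by (intro continuous_intros) (auto simp: less_imp_neq[symmetric])
  show "ell_gauge k lam (t *\<^sub>R z) = t\<^sup>2 * ell_gauge k lam z" for t z
    by (simp add: ell_gauge_def ell_form_eq_sum power_mult_distrib power_divide sum_distrib_left distrib_left)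
  show "1 / lam\<^sup>2 > 0"
    using lam by simp
  show "1 / lam\<^sup>2 * (norm z)\<^sup>2 \<le> ell_gauge k lam z" for z
  proof -
    have le: "a\<^sup>2 / lam\<^sup>2 \<le> (a / s)\<^sup>2" if "0 < s" "s \<le> lam" for a s
      using that by (auto simp: power_divide intro!: divide_left_mono power_mono mult_pos_pos)
    have "(norm (fst z))\<^sup>2 = (\<Sum>j\<in>UNIV. (fst z $ j)\<^sup>2)"
      by (rule norm_vec_power2)
    then have "1 / lam\<^sup>2 * (norm z)\<^sup>2 = (\<Sum>j\<in>UNIV. (fst z $ j)\<^sup>2 / lam\<^sup>2) + (snd z)\<^sup>2 / lam\<^sup>2"
      by (simp add: norm_prod_def add_divide_distrib sum_divide_distrib sum_nonneg)
    also have "\<dots> \<le> ell_gauge k lam z"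
      unfolding ell_gauge_def ell_form_eq_sum
      by (intro add_mono sum_mono le semiaxis_pos semiaxis_le nu_pos nu_le lam)
    finally show ?thesis .
  qed
qed

lemma G_eq:
  assumes lam: "lam > 1" and f: "test_function f"
  shows "G k lam f u w = (\<integral>z. f z * iexp (w * ell_gauge k lam (z - (u, 0))) \<partial>lborel)"
proof -
  interpret quadratic_gauge "ell_gauge k lam" "1 / lam\<^sup>2"
    by (rule ell_gauge_quadratic[OF lam])
  have "RE k lam f u = (\<lambda>t. LINT z:gball (u, 0) t|lborel. f z)"
    by (simp add: RE_def[abs_def] ell_def gball_def ell_gauge_def case_prod_beta')
  then show ?thesis
    unfolding G_def by (simp only: integral_derivative_ball_integral[OF f])
qed

text \<open>Expanding the square: for this centre the cross term is the linear phase of a Fourier transform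
  in \<open>\<beta>\<close>, and the remaining term depends on \<open>\<alpha>\<close> alone.\<close>

lemma ell_gauge_shift:
  fixes k :: "'m::finite" and \<alpha> :: "real ^ 'm"
  assumes lam: "lam > 1" and g: "\<gamma> \<noteq> 0"
  defines "\<beta> \<equiv> \<chi> j. \<alpha> $ j / semiaxis k lam j"
  shows "\<gamma> * ell_gauge k lam (z - ((\<chi> j. \<alpha> $ j * semiaxis k lam j / (2 * \<gamma>)), 0)) =
         \<gamma> * ell_gauge k lam z - \<beta> \<bullet> fst z + (norm \<alpha>)\<^sup>2 / (4 * \<gamma>)"
proof -
  let ?s = "semiaxis k lam"
  have "\<gamma> * ((fst z $ j - \<alpha> $ j * ?s j / (2 * \<gamma>)) / ?s j)\<^sup>2 =
      \<gamma> * (fst z $ j / ?s j)\<^sup>2 - \<alpha> $ j / ?s j * fst z $ j + (\<alpha> $ j)\<^sup>2 / (4 * \<gamma>)" for j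
    using semiaxis_pos[OF lam, of k j] g by (simp add: field_simps power2_eq_square)
  then have "(\<Sum>j\<in>UNIV. \<gamma> * ((fst z $ j - \<alpha> $ j * ?s j / (2 * \<gamma>)) / ?s j)\<^sup>2) =
      (\<Sum>j\<in>UNIV. \<gamma> * (fst z $ j / ?s j)\<^sup>2) - \<beta> \<bullet> fst z + (\<Sum>j\<in>UNIV. (\<alpha> $ j)\<^sup>2 / (4 * \<gamma>))"
    by (simp add: sum.distrib sum_subtractf \<beta>_def inner_vec_def)
  moreover have "(\<Sum>j\<in>UNIV. (\<alpha> $ j)\<^sup>2 / (4 * \<gamma>)) = (norm \<alpha>)\<^sup>2 / (4 * \<gamma>)"
    by (simp add: norm_vec_power2 sum_divide_distrib)
  ultimately show ?thesis
    by (simp add: ell_gauge_def ell_form_eq_sum distrib_left sum_distrib_left)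
qed

lemma test_function_chirp:
  fixes k :: "'m::finite"
  assumes lam: "lam > 1" and f: "test_function f"
  shows "test_function (\<lambda>z. f z * iexp (\<gamma> * ell_gauge k lam z))"
proof (rule test_function_mult[OF f], rule C_diff_iexp)
  let ?s = "semiaxis k lam"
  let ?B = "\<lambda>v x. (\<Sum>j\<in>UNIV. 2 * (fst x $ j / ?s j) * (fst v $ j / ?s j)) + 2 * (snd x / nu lam) * (snd v / nu lam)"
  have sq: "((\<lambda>z. (L z)\<^sup>2) has_derivative (\<lambda>v. 2 * L x * L v)) (at x)"
    if "bounded_linear L" for L :: "(real ^ 'm) \<times> real \<Rightarrow> real" and x
    by (rule has_derivative_eq_rhs[OF has_derivative_power[OF bounded_linear_imp_has_derivative[OF that], where n = 2]])
      (simp add: fun_eq_iff)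
  have lin: "bounded_linear (\<lambda>z::(real ^ 'm) \<times> real. fst z $ j / a)" "bounded_linear (\<lambda>z::(real ^ 'm) \<times> real. snd z / a)" for j a
    by (intro bounded_linear_compose[OF bounded_linear_divide] bounded_linear_compose[OF bounded_linear_vec_nth]
        bounded_linear_fst bounded_linear_snd)+
  show "(ell_gauge k lam has_derivative (\<lambda>v. ?B v x)) (at x)" for x
    unfolding ell_gauge_def[abs_def] ell_form_eq_sum
    by (intro has_derivative_add has_derivative_sum sq lin)
  show "C_diff m (\<lambda>x. complex_of_real (?B v x))" for m v
    by (intro C_diff_bounded_linear bounded_linear_compose[OF bounded_linear_of_real] bounded_linear_add
        bounded_linear_sum bounded_linear_compose[OF bounded_linear_mult_left]
        bounded_linear_compose[OF bounded_linear_mult_right] lin)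
qed

text \<open>The first exponential of the integrand removes the term \<open>(norm \<alpha>)\<^sup>2 / (4 * \<gamma>)\<close> coming from the
  centre of the ellipsoid.  What is left of the transform \<open>G\<close> is a partial Fourier transform of \<open>f\<close> times a
  quadratic phase.\<close>

lemma inv_integrand_eq:
  fixes k :: "'m::finite"
  assumes lam: "lam > 1" and f: "test_function f" and g: "\<gamma> \<noteq> 0"
  defines "\<beta> \<equiv> \<lambda>\<alpha>. \<chi> j. \<alpha> $ j / semiaxis k lam j"
  shows "inv_integrand k lam f x xn \<gamma> \<alpha> =
     iexp (- (\<gamma> * ell_form k lam x xn)) *
       (partial_fourier (\<lambda>z. f z * iexp (\<gamma> * ell_gauge k lam z)) (\<beta> \<alpha>) * iexp (\<beta> \<alpha> \<bullet> x))"
proof -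
  have shift: "\<gamma> * ell_gauge k lam (z - ((\<chi> j. \<alpha> $ j * semiaxis k lam j / (2 * \<gamma>)), 0)) =
         \<gamma> * ell_gauge k lam z - \<beta> \<alpha> \<bullet> fst z + (norm \<alpha>)\<^sup>2 / (4 * \<gamma>)" for z
    unfolding \<beta>_def by (rule ell_gauge_shift[OF lam g])
  have iexp_split: "iexp (a - b + c) = iexp c * (iexp a * iexp (- b))" for a b c :: real
    unfolding exp_add[symmetric] by (simp add: algebra_simps)
  have "G k lam f (\<chi> j. \<alpha> $ j * semiaxis k lam j / (2 * \<gamma>)) \<gamma> =
      (\<integral>z. iexp ((norm \<alpha>)\<^sup>2 / (4 * \<gamma>)) * (f z * iexp (\<gamma> * ell_gauge k lam z) * iexp (- (\<beta> \<alpha> \<bullet> fst z))) \<partial>lborel)"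
    unfolding G_eq[OF lam f] shift iexp_split
    by (intro Bochner_Integration.integral_cong refl) (simp only: mult_ac)
  also have "\<dots> = iexp ((norm \<alpha>)\<^sup>2 / (4 * \<gamma>)) * partial_fourier (\<lambda>z. f z * iexp (\<gamma> * ell_gauge k lam z)) (\<beta> \<alpha>)"
    unfolding partial_fourier_def by (rule integral_mult_right_zero)
  finally have Geq: "G k lam f (\<chi> j. \<alpha> $ j * semiaxis k lam j / (2 * \<gamma>)) \<gamma> = \<dots>" .
  have phase: "\<alpha> \<bullet> (\<chi> j. x $ j / semiaxis k lam j) = \<beta> \<alpha> \<bullet> x"
    by (simp add: \<beta>_def inner_vec_def)
  have "exp (- \<i> * complex_of_real ((norm \<alpha>)\<^sup>2 / (4 * \<gamma>))) * iexp ((norm \<alpha>)\<^sup>2 / (4 * \<gamma>)) = 1"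
    by (simp add: exp_add[symmetric])
  then show ?thesis
    unfolding inv_integrand_def Geq phase by (simp add: mult_ac)
qed

lemma Basis_real_vec: "(Basis :: (real ^ 'm::finite) set) = range (\<lambda>j. axis j 1)"
  by (auto simp: Basis_vec_def)

lemma
  fixes g :: "real ^ 'm \<Rightarrow> complex" and s :: "'m::finite \<Rightarrow> real"
  assumes g: "integrable lborel g" and s: "\<And>j. s j > 0"
  shows integrable_vec_dilation: "integrable lborel (\<lambda>\<alpha>. g (\<chi> j. \<alpha> $ j / s j))"
    and integral_vec_dilation: "(\<integral>\<alpha>. g (\<chi> j. \<alpha> $ j / s j) \<partial>lborel) = complex_of_real (\<Prod>j\<in>UNIV. s j) * (\<integral>\<beta>. g \<beta> \<partial>lborel)"
proof -
  define c where "c b = b \<bullet> (\<chi> j. s j)" for b :: "real ^ 'm"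
  let ?h = "\<lambda>\<alpha>::real ^ 'm. g (\<chi> j. \<alpha> $ j / s j)"
  have c: "c (axis j 1) = s j" for j
    by (simp add: c_def inner_axis')
  have c0: "c b \<noteq> 0" if "b \<in> Basis" for b
    using that s by (auto simp: Basis_real_vec c less_imp_neq[symmetric])
  have [measurable]: "g \<in> borel_measurable borel"
    using g by auto
  have "continuous_on UNIV (\<lambda>\<alpha>::real ^ 'm. \<chi> j. \<alpha> $ j / s j)"
    using s by (intro continuous_intros) (auto simp: less_imp_neq[symmetric])
  from borel_measurable_continuous_onI[OF this]
  have meas: "?h \<in> borel_measurable borel"
    by measurable
  have T: "(0 + (\<Sum>b\<in>Basis. (c b * (\<beta> \<bullet> b)) *\<^sub>R b)) $ j = s j * \<beta> $ j" for \<beta> :: "real ^ 'm" and j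
  proof -
    have "(\<Sum>b\<in>Basis. (c b * (\<beta> \<bullet> b)) *\<^sub>R b) \<bullet> axis j 1 = c (axis j 1) * (\<beta> \<bullet> axis j 1)"
      by (rule inner_sum_left_Basis) (auto simp: Basis_real_vec)
    then show ?thesis
      by (simp add: c inner_axis)
  qed
  have hT: "?h (0 + (\<Sum>b\<in>Basis. (c b * (\<beta> \<bullet> b)) *\<^sub>R b)) = g \<beta>" for \<beta>
  proof -
    have "(\<chi> j. (0 + (\<Sum>b\<in>Basis. (c b * (\<beta> \<bullet> b)) *\<^sub>R b)) $ j / s j) = \<beta>"
      unfolding T using s by (simp add: vec_eq_iff less_imp_neq[symmetric])
    then show ?thesis by simp
  qed
  have P: "(\<Prod>b\<in>Basis. \<bar>c b\<bar>) = (\<Prod>j\<in>UNIV. s j)"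
    unfolding Basis_real_vec using s
    by (subst prod.reindex) (auto simp: c inj_on_def axis_eq_axis intro!: prod.cong abs_of_pos)
  have hT': "(\<lambda>\<beta>. ?h (0 + (\<Sum>b\<in>Basis. (c b * (\<beta> \<bullet> b)) *\<^sub>R b))) = g"
    by (rule ext) (rule hT)
  show "integrable lborel ?h"
  proof (rule lborel_integrable_affine_euclidean[where c = c and a = 0, OF meas c0])
    show "integrable lborel (\<lambda>\<beta>. ?h (0 + (\<Sum>b\<in>Basis. (c b * (\<beta> \<bullet> b)) *\<^sub>R b)))"
      unfolding hT' by (rule g)
  qed
  show "(\<integral>\<alpha>. ?h \<alpha> \<partial>lborel) = complex_of_real (\<Prod>j\<in>UNIV. s j) * (\<integral>\<beta>. g \<beta> \<partial>lborel)"
  proof -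
    have "(\<integral>\<alpha>. ?h \<alpha> \<partial>lborel) = (\<Prod>j\<in>UNIV. s j) *\<^sub>R (\<integral>\<beta>. g \<beta> \<partial>lborel)"
      using lborel_integral_affine_euclidean[where c = c and a = 0, OF meas] c0 unfolding hT' P by blast
    then show ?thesis
      unfolding scaleR_conv_of_real .
  qed
qed

text \<open>Fourier inversion replaces the first variable of \<open>f\<close> by \<open>x\<close>.  The phase there is the
  difference of the quadratic forms at \<open>(x, s)\<close> and \<open>(x, xn)\<close>, in which only \<open>s\<^sup>2 - xn\<^sup>2\<close>
  survives.\<close>

lemma
  fixes k :: "'m::finite"
  assumes lam: "lam > 1" and f: "test_function f" and g: "\<gamma> \<noteq> 0"
  shows inv_integrand_integrable: "integrable lborel (inv_integrand k lam f x xn \<gamma>)"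
    and integral_inv_integrand: "(\<integral>\<alpha>. inv_integrand k lam f x xn \<gamma> \<alpha> \<partial>lborel) =
      complex_of_real (lam * nu lam ^ (CARD('m) - 1) * (2 * pi) ^ CARD('m)) *
        (\<integral>s. f (x, s) * iexp (\<gamma> * (1 / (nu lam)\<^sup>2 * (s\<^sup>2 - xn\<^sup>2))) \<partial>lborel)"
proof -
  let ?K = "\<lambda>z. f z * iexp (\<gamma> * ell_gauge k lam z)"
  have K: "test_function ?K"
    by (rule test_function_chirp[OF lam f])
  let ?g = "\<lambda>\<beta>. partial_fourier ?K \<beta> * iexp (\<beta> \<bullet> x)"
  have int: "integrable lborel ?g"
  proof (rule Bochner_Integration.integrable_bound[OF partial_fourier_integrable[OF K]])
    have [measurable]: "partial_fourier ?K \<in> borel_measurable borel"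
      using partial_fourier_integrable[OF K] by auto
    show "?g \<in> borel_measurable lborel"
      by measurable
  qed (simp add: norm_mult)
  have eq: "inv_integrand k lam f x xn \<gamma> = (\<lambda>\<alpha>. iexp (- (\<gamma> * ell_form k lam x xn)) * ?g (\<chi> j. \<alpha> $ j / semiaxis k lam j))"
    by (rule ext) (rule inv_integrand_eq[OF lam f g])
  show "integrable lborel (inv_integrand k lam f x xn \<gamma>)"
    unfolding eq by (intro integrable_mult_right integrable_vec_dilation[OF int] semiaxis_pos lam)
  have "(\<integral>\<alpha>. inv_integrand k lam f x xn \<gamma> \<alpha> \<partial>lborel) =
      iexp (- (\<gamma> * ell_form k lam x xn)) * (complex_of_real (\<Prod>j\<in>UNIV. semiaxis k lam j) * (\<integral>\<beta>. ?g \<beta> \<partial>lborel))"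
    unfolding eq integral_mult_right_zero by (subst integral_vec_dilation[OF int semiaxis_pos[OF lam]]) (rule refl)
  also have "(\<integral>\<beta>. ?g \<beta> \<partial>lborel) = complex_of_real ((2 * pi) ^ CARD('m)) * (\<integral>s. ?K (x, s) \<partial>lborel)"
    using partial_fourier_inversion[OF K] by simp
  also have "iexp (- (\<gamma> * ell_form k lam x xn)) * (complex_of_real (\<Prod>j\<in>UNIV. semiaxis k lam j) *
        (complex_of_real ((2 * pi) ^ CARD('m)) * (\<integral>s. ?K (x, s) \<partial>lborel))) =
      complex_of_real (lam * nu lam ^ (CARD('m) - 1) * (2 * pi) ^ CARD('m)) *
        (iexp (- (\<gamma> * ell_form k lam x xn)) * (\<integral>s. ?K (x, s) \<partial>lborel))"
    unfolding prod_semiaxis by (simp add: mult_ac)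
  also have "iexp (- (\<gamma> * ell_form k lam x xn)) * (\<integral>s. ?K (x, s) \<partial>lborel) =
      (\<integral>s. iexp (- (\<gamma> * ell_form k lam x xn)) * ?K (x, s) \<partial>lborel)"
    by (rule integral_mult_right_zero[symmetric])
  also have "\<dots> = (\<integral>s. f (x, s) * iexp (\<gamma> * (1 / (nu lam)\<^sup>2 * (s\<^sup>2 - xn\<^sup>2))) \<partial>lborel)"
  proof (intro Bochner_Integration.integral_cong refl)
    fix s
    have "\<gamma> * (1 / (nu lam)\<^sup>2 * (s\<^sup>2 - xn\<^sup>2)) = - (\<gamma> * ell_form k lam x xn) + \<gamma> * ell_gauge k lam (x, s)"
      by (simp add: ell_gauge_def ell_form_def algebra_simps diff_divide_distrib)
    then have "iexp (\<gamma> * (1 / (nu lam)\<^sup>2 * (s\<^sup>2 - xn\<^sup>2))) =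
        iexp (- (\<gamma> * ell_form k lam x xn)) * iexp (\<gamma> * ell_gauge k lam (x, s))"
      by (simp only: of_real_add distrib_left exp_add)
    then show "iexp (- (\<gamma> * ell_form k lam x xn)) * ?K (x, s) = f (x, s) * iexp (\<gamma> * (1 / (nu lam)\<^sup>2 * (s\<^sup>2 - xn\<^sup>2)))"
      by (simp only: mult_ac)
  qed
  finally show "(\<integral>\<alpha>. inv_integrand k lam f x xn \<gamma> \<alpha> \<partial>lborel) =
      complex_of_real (lam * nu lam ^ (CARD('m) - 1) * (2 * pi) ^ CARD('m)) *
        (\<integral>s. f (x, s) * iexp (\<gamma> * (1 / (nu lam)\<^sup>2 * (s\<^sup>2 - xn\<^sup>2))) \<partial>lborel)" .
qed

theorem theorem4:
  fixes n :: nat and k :: "'m::finite" and lam :: real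
    and f :: "(real ^ 'm) \<times> real \<Rightarrow> complex"
    and x :: "real ^ 'm" and xn :: real
  assumes dim: "n = CARD('m) + 1"
    and lam: "lam > 1"
    and f: "test_function f"
    and even: "\<And>y yn. f (y, yn) = f (y, - yn)"
    and xn: "xn > 0"
  shows "(\<forall>\<gamma>. \<gamma> \<noteq> 0 \<longrightarrow> integrable lborel (inv_integrand k lam f x xn \<gamma>)) \<and>
         (\<lambda>\<gamma>. LINT \<alpha>|lborel. inv_integrand k lam f x xn \<gamma> \<alpha>) integrable_on UNIV \<and>
         f (x, xn) = complex_of_real (xn / ((2 * pi) ^ n * (nu lam * C n lam))) *
           integral UNIV (\<lambda>\<gamma>. LINT \<alpha>|lborel. inv_integrand k lam f x xn \<gamma> \<alpha>)"
proof -
  define K where "K = lam * nu lam ^ (CARD('m) - 1) * (2 * pi) ^ CARD('m)"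
  obtain r where r: "\<And>z. f z \<noteq> 0 \<Longrightarrow> norm z \<le> r"
    using test_function_bounded_support[OF f] by blast
  have supp: "f (x, s) = 0" if "\<bar>s\<bar> > r" for s
    using r[of "(x, s)"] norm_snd_le[of s x] that by force
  have cont: "continuous_on UNIV (\<lambda>s. f (x, s))"
    by (rule continuous_on_compose2[OF test_function_continuous[OF f]]) (auto intro!: continuous_intros)
  have "((\<lambda>s. (x, s)) has_derivative (\<lambda>h. (0, h))) (at xn)"
    by (auto intro!: derivative_eq_intros)
  from has_derivative_compose[OF this test_function_has_derivative[OF f]]
  have "(\<lambda>s. f (x, s)) differentiable at xn"
    by (auto simp: differentiable_def)
  then have der: "((\<lambda>s. f (x, s)) has_vector_derivative vector_derivative (\<lambda>s. f (x, s)) (at xn)) (at xn)"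
    by (simp add: vector_derivative_works)
  have c: "1 / (nu lam)\<^sup>2 > 0"
    using nu_pos[OF lam] by simp
  have "((\<lambda>\<gamma>. \<integral>s. f (x, s) * iexp (\<gamma> * (1 / (nu lam)\<^sup>2 * (s\<^sup>2 - xn\<^sup>2))) \<partial>lborel) has_integral
           complex_of_real (2 * pi / (1 / (nu lam)\<^sup>2 * xn)) * f (x, xn)) UNIV"
    by (rule radial_fourier_inversion[OF cont _ supp der xn c]) (rule even[symmetric])
  then have "((\<lambda>\<gamma>. complex_of_real K * (\<integral>s. f (x, s) * iexp (\<gamma> * (1 / (nu lam)\<^sup>2 * (s\<^sup>2 - xn\<^sup>2))) \<partial>lborel)) has_integral
           complex_of_real K * (complex_of_real (2 * pi / (1 / (nu lam)\<^sup>2 * xn)) * f (x, xn))) UNIV"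
    by (rule has_integral_mult_right)
  \<comment> \<open>the inner integral is only evaluated for \<open>\<gamma> \<noteq> 0\<close>; the exceptional point is a null set\<close>
  then have I: "((\<lambda>\<gamma>. LINT \<alpha>|lborel. inv_integrand k lam f x xn \<gamma> \<alpha>) has_integral
           complex_of_real K * (complex_of_real (2 * pi / (1 / (nu lam)\<^sup>2 * xn)) * f (x, xn))) UNIV"
    by (rule has_integral_spike[OF negligible_sing[of 0], rotated]) (simp add: integral_inv_integrand[OF lam f] K_def)
  have "CARD('m) > 0"
    by simp
  then have "nu lam ^ CARD('m) = nu lam * nu lam ^ (CARD('m) - 1)"
    by (metis Suc_diff_1 power_Suc)
  then have "xn / ((2 * pi) ^ n * (nu lam * C n lam)) * (K * (2 * pi / (1 / (nu lam)\<^sup>2 * xn))) = 1"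
    using nu_pos[OF lam] xn lam by (simp add: dim C_def K_def field_simps power2_eq_square)
  then have "f (x, xn) = complex_of_real (xn / ((2 * pi) ^ n * (nu lam * C n lam))) *
      (complex_of_real K * (complex_of_real (2 * pi / (1 / (nu lam)\<^sup>2 * xn)) * f (x, xn)))"
    by (metis (no_types, lifting) mult.assoc mult_1 of_real_1 of_real_mult)
  then show ?thesis
    using I inv_integrand_integrable[OF lam f] by (auto simp: integral_unique[OF I] integrable_on_def)
qed

end
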